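(* Let $p\geq3$ be a prime. If a hereditary $3$-graph property $\mathcal{H}$ has $\mathrm{GS}_p(n)\in\mathrm{Trip}(\mathcal{H})$ for every $n\geq1$, then $\mathcal{H}$ requires non-binary $\mathrm{disc}_{2,3}$-error, i.e. $\mathcal{H}$ does not admit binary $\mathrm{disc}_{2,3}$-error.
   Context: For distinct $x,y,z$ write $xy=\{x,y\}$, $xyz=\{x,y,z\}$; $[n]=\{1,\dots,n\}$. $K_2[X,Y]=\{xy: x\in X,y\in Y,x\neq y\}$. A $3$-graph is a pair $H=(V,F)$ with $F\subseteq\binom{V}{3}$. A hereditary $3$-graph property is a class of finite $3$-graphs closed under isomorphism and induced sub-$3$-graphs. Given $H=(V,F)$, $\mathrm{Trip}(H)$ is the $3$-partite $3$-graph with vertex set $\{x_v:v\in V\}\cup\{y_v:v\in V\}\cup\{z_v:v\in V\}$ (three disjoint copies of $V$) and edge set $\{x_vy_{v'}z_{v''}:vv'v''\in F\}$. For a $3$-graph $\Gamma$, $\Gamma\in\mathrm{Trip}(\mathcal{H})$ means that for some $H\in\mathcal{H}$, $\Gamma$ is isomorphic to an induced sub-$3$-graph of $\mathrm{Trip}(H)$. $A(p,n)=\{x\in\mathbb{F}_p^n:\exists i\in[n]\text{ with }x_i=1\text{ and }x_j=0\text{ for all }1\leq j<i\}$. $\mathrm{GS}_p(n)$ is the $3$-partite $3$-graph with vertex set $\{a_g,b_g,c_g:g\in\mathbb{F}_p^n\}$ and edge set $\{a_gb_{g'}c_{g''}:g+g'+g''\in A(p,n)\}$. A bipartite graph $(U\cup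 W,E)$ with $|E|=d|U||W|$ has $\mathrm{disc}_2(\epsilon)$ if for all $U'\subseteq U$, $W'\subseteq W$, $\big||E\cap K_2[U',W']|-d|U'||W'|\big|\leq\epsilon|U||W|$; it has $\mathrm{disc}_2(\epsilon;d')$ if moreover $\big||E|-d'|U||W|\big|\leq\epsilon|U||W|$. For a graph $G$, $K_3^{(2)}(G)$ is the set of vertex sets of triangles of $G$. If $G=(V_1\cup V_2\cup V_3,E)$ is a $3$-partite graph and $H'=(V_1\cup V_2\cup V_3,F')$ is a $3$-graph with $F'\subseteq K_3^{(2)}(G)$ and $|F'|=d_3|K_3^{(2)}(G)|$, then $(H',G)$ has $\mathrm{disc}_{2,3}(\epsilon_1,\epsilon_2)$ if there is $d_2\in(0,1]$ such that each bipartite graph $G[V_i,V_j]$ ($1\leq i<j\leq3$) has $\mathrm{disc}_2(\epsilon_2;d_2)$ and for every (not necessarily induced) subgraph $G'\subseteq G$, $\big||F'\cap K_3^{(2)}(G')|-d_3|K_3^{(2)}(G')|\big|\leq\epsilon_1d_2^3|V_1||V_2||V_3|$. A $(t,\ell,\epsilon_1,\epsilon_2)$-decomposition $\mathcal{P}$ of a set $V$ consists of a partition $V=V_1\cup\dots\cup V_t$ with $|V_1|\leq\dots\leq|V_t|\leq|V_1|+1$ and for each $ij\in\binom{[t]}{2}$ a partition $K_2[V_i,V_j]=\bigcup_{\alpha\leq\ell}P_{ij}^\alpha$, such that for all but at most $\epsilon_1|V|^3$ triples $xyz\in\binom V3$ there are $ijk\in\binom{[t]}{3}$ and $\alpha,\beta,\gamma\in[\ell]$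 with $xy\in P^\alpha_{ij}$, $xz\in P^\beta_{ik}$, $yz\in P^\gamma_{jk}$, and each of $P^\alpha_{ij},P^\beta_{ik},P^\gamma_{jk}$ (as bipartite graphs) has $\mathrm{disc}_2(\epsilon_2;1/\ell)$. A triad of $\mathcal{P}$ is a $3$-partite graph $G_{ijk}^{\alpha,\beta,\gamma}=(V_i\cup V_j\cup V_k,P_{ij}^\alpha\cup P_{ik}^\beta\cup P_{jk}^\gamma)$ with $ijk\in\binom{[t]}{3}$, $\alpha,\beta,\gamma\in[\ell]$. For $H=(V,F)$, a triad $G$ of $\mathcal{P}$ has $\mathrm{disc}_{2,3}(\epsilon_1,\epsilon_2)$ with respect to $H$ if $(H',G)$ does, where $H'=(V_i\cup V_j\cup V_k,F\cap K_3^{(2)}(G))$. $\mathcal{H}$ admits binary $\mathrm{disc}_{2,3}$-error if for all $t_0,\ell_0\geq1$, $\epsilon_1>0$, $\epsilon_2:\mathbb{N}\to(0,1]$ there are $N,T,L$ such that for every $H=(V,F)\in\mathcal{H}$ with $|V|\geq N$ there are $t_0\leq t\leq T$, $\ell_0\leq\ell\leq L$, a $(t,\ell,\epsilon_1,\epsilon_2(\ell))$-decomposition $\mathcal{P}$ of $V$, and $\Gamma\subseteq\binom{[t]}{2}$ with $|\Gamma|\leq\epsilon_1t^2$ such that every triad $G_{ijk}^{\alpha,\beta,\gamma}$ of $\mathcal{P}$ with $ij,ik,jk\notin\Gamma$ has $\mathrm{disc}_{2,3}(\epsilon_1,\epsilon_2(\ell))$ with respect to $H$. *)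

theory Defs
  imports Complex_Main
    "HOL-Library.FuncSet"
    "HOL-Library.Disjoint_Sets"
    "HOL-Library.Ramsey"
    "HOL-Number_Theory.Residues"
begin

section \<open>Graphs and 3-graphs\<close>

text \<open>
  A graph or a 3-graph is a pair of a vertex set and an edge set.  Library notation:
  \<open>[A]\<^bsup>k\<^esup>\<close> is the set of all \<open>k\<close>-element subsets of \<open>A\<close>.
\<close>

type_synonym 'a hgraph = "'a set \<times> 'a set set"

abbreviation hverts :: "'a hgraph \<Rightarrow> 'a set" where "hverts \<equiv> fst"

abbreviation hedges :: "'a hgraph \<Rightarrow> 'a set set" where "hedges \<equiv> snd"

definition graph2 :: "'a hgraph \<Rightarrow> bool" where
  "graph2 G \<longleftrightarrow> hedges G \<subseteq> [hverts G]\<^bsup>2\<^esup>"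

definition graph3 :: "'a hgraph \<Rightarrow> bool" where
  "graph3 H \<longleftrightarrow> hedges H \<subseteq> [hverts H]\<^bsup>3\<^esup>"

definition subgraph2 :: "'a hgraph \<Rightarrow> 'a hgraph \<Rightarrow> bool" where
  "subgraph2 G' G \<longleftrightarrow> graph2 G' \<and> hverts G' \<subseteq> hverts G \<and> hedges G' \<subseteq> hedges G"

definition hgraph_iso :: "'a hgraph \<Rightarrow> 'b hgraph \<Rightarrow> bool" where
  "hgraph_iso H H' \<longleftrightarrow>
     (\<exists>f. bij_betw f (hverts H) (hverts H') \<and> hedges H' = (\<lambda>e. f ` e) ` hedges H)"

definition induced_sub :: "'a hgraph \<Rightarrow> 'a set \<Rightarrow> 'a hgraph" where
  "induced_sub H U = (U, {e \<in> hedges H. e \<subseteq> U})"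

text \<open>
  Every finite 3-graph is isomorphic to one whose vertices are natural numbers, so an
  isomorphism-closed class of finite 3-graphs is determined by its members on
  \<^typ>\<open>nat\<close>, and is represented by the set of these.
\<close>

definition hereditary_property :: "nat hgraph set \<Rightarrow> bool" where
  "hereditary_property \<H> \<longleftrightarrow>
     (\<forall>H\<in>\<H>. finite (hverts H) \<and> graph3 H) \<and>
     (\<forall>H\<in>\<H>. \<forall>H'. graph3 H' \<and> hgraph_iso H H' \<longrightarrow> H' \<in> \<H>) \<and>
     (\<forall>H\<in>\<H>. \<forall>U. U \<subseteq> hverts H \<longrightarrow> induced_sub H U \<in> \<H>)"

section \<open>The 3-graphs \<open>Trip(H)\<close> and \<open>GS\<^sub>p(n)\<close>\<close>

text \<open>
  Disjoint copies are made by tagging: \<open>x\<^sub>v, y\<^sub>v, z\<^sub>v\<close> (and \<open>a\<^sub>g, b\<^sub>g, c\<^sub>g\<close>) are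
  \<open>(1, v), (2, v), (3, v)\<close>.
\<close>

definition Trip :: "'a hgraph \<Rightarrow> (nat \<times> 'a) hgraph" where
  "Trip H = ({1,2,3} \<times> hverts H,
     {{(1, v), (2, v'), (3, v'')} | v v' v''. {v, v', v''} \<in> hedges H})"

definition in_Trip :: "'b hgraph \<Rightarrow> 'a hgraph set \<Rightarrow> bool" where
  "in_Trip \<Gamma> \<H> \<longleftrightarrow>
     (\<exists>H\<in>\<H>. \<exists>U. U \<subseteq> hverts (Trip H) \<and> hgraph_iso \<Gamma> (induced_sub (Trip H) U))"

abbreviation F_p :: "nat \<Rightarrow> int ring" where "F_p p \<equiv> residue_ring (int p)"

definition F_vecs :: "nat \<Rightarrow> nat \<Rightarrow> (nat \<Rightarrow> int) set" where
  "F_vecs p n = {1..n} \<rightarrow>\<^sub>E carrier (F_p p)"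

definition vec_add :: "nat \<Rightarrow> nat \<Rightarrow> (nat \<Rightarrow> int) \<Rightarrow> (nat \<Rightarrow> int) \<Rightarrow> (nat \<Rightarrow> int)" where
  "vec_add p n g h = (\<lambda>i\<in>{1..n}. g i \<oplus>\<^bsub>F_p p\<^esub> h i)"

definition GS_A :: "nat \<Rightarrow> nat \<Rightarrow> (nat \<Rightarrow> int) set" where
  "GS_A p n = {x \<in> F_vecs p n.
     \<exists>i\<in>{1..n}. x i = \<one>\<^bsub>F_p p\<^esub> \<and> (\<forall>j. 1 \<le> j \<and> j < i \<longrightarrow> x j = \<zero>\<^bsub>F_p p\<^esub>)}"

definition GS :: "nat \<Rightarrow> nat \<Rightarrow> (nat \<times> (nat \<Rightarrow> int)) hgraph" where
  "GS p n = ({1,2,3} \<times> F_vecs p n,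
     {{(1, g), (2, g'), (3, g'')} | g g' g''.
        g \<in> F_vecs p n \<and> g' \<in> F_vecs p n \<and> g'' \<in> F_vecs p n \<and>
        vec_add p n (vec_add p n g g') g'' \<in> GS_A p n})"

section \<open>Quasirandomness\<close>

definition K2 :: "'a set \<Rightarrow> 'a set \<Rightarrow> 'a set set" where
  "K2 X Y = {{x, y} | x y. x \<in> X \<and> y \<in> Y \<and> x \<noteq> y}"

definition K3 :: "'a hgraph \<Rightarrow> 'a set set" where
  "K3 G = {{x, y, z} | x y z. x \<noteq> y \<and> x \<noteq> z \<and> y \<noteq> z \<and>
     {x, y} \<in> hedges G \<and> {x, z} \<in> hedges G \<and> {y, z} \<in> hedges G}"

text \<open>
  The following predicates are meant for a finite bipartite graph with parts \<open>U, W\<close> and edge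
  set \<open>E\<close>.  If a part is empty, the number \<open>d\<close> is not determined, but then the inequality
  holds for every \<open>d\<close>.
\<close>

definition disc2 :: "real \<Rightarrow> 'a set \<Rightarrow> 'a set \<Rightarrow> 'a set set \<Rightarrow> bool" where
  "disc2 \<epsilon> U W E \<longleftrightarrow>
     (\<exists>d::real. real (card E) = d * real (card U) * real (card W) \<and>
       (\<forall>U' W'. U' \<subseteq> U \<and> W' \<subseteq> W \<longrightarrow>
          \<bar>real (card (E \<inter> K2 U' W')) - d * real (card U') * real (card W')\<bar>
            \<le> \<epsilon> * real (card U) * real (card W)))"

definition disc2_dens :: "real \<Rightarrow> real \<Rightarrow> 'a set \<Rightarrow> 'a set \<Rightarrow> 'a set set \<Rightarrow> bool" where
  "disc2_dens \<epsilon> d' U W E \<longleftrightarrow> disc2 \<epsilon> U W E \<and>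
     \<bar>real (card E) - d' * real (card U) * real (card W)\<bar> \<le> \<epsilon> * real (card U) * real (card W)"

text \<open>
  Here \<open>G\<close> is a finite 3-partite graph with parts \<open>V1, V2, V3\<close> and \<open>H'\<close> is a 3-graph on the
  same vertices with \<open>hedges H' \<subseteq> K3 G\<close>.  As above, if \<open>K3 G\<close> is empty, then \<open>d3\<close> is not
  determined and its choice does not matter.
\<close>

definition disc23 ::
  "real \<Rightarrow> real \<Rightarrow> 'a set \<Rightarrow> 'a set \<Rightarrow> 'a set \<Rightarrow> 'a hgraph \<Rightarrow> 'a hgraph \<Rightarrow> bool" where
  "disc23 \<epsilon>1 \<epsilon>2 V1 V2 V3 H' G \<longleftrightarrow>
     (\<exists>d3::real. real (card (hedges H')) = d3 * real (card (K3 G)) \<and>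
       (\<exists>d2::real. 0 < d2 \<and> d2 \<le> 1 \<and>
          disc2_dens \<epsilon>2 d2 V1 V2 (hedges G \<inter> K2 V1 V2) \<and>
          disc2_dens \<epsilon>2 d2 V1 V3 (hedges G \<inter> K2 V1 V3) \<and>
          disc2_dens \<epsilon>2 d2 V2 V3 (hedges G \<inter> K2 V2 V3) \<and>
          (\<forall>G'. subgraph2 G' G \<longrightarrow>
             \<bar>real (card (hedges H' \<inter> K3 G')) - d3 * real (card (K3 G'))\<bar>
               \<le> \<epsilon>1 * d2 ^ 3 * real (card V1) * real (card V2) * real (card V3))))"

section \<open>Decompositions and binary error\<close>

text \<open>
  The part \<open>P\<^sub>i\<^sub>j\<^sup>\<alpha>\<close> is \<open>P {i, j} \<alpha>\<close>, since it is indexed by the unordered pair \<open>ij\<close>.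
  Only the values for distinct \<open>i, j \<in> {1..t}\<close> and \<open>\<alpha> \<in> {1..l}\<close> matter.
  Partitions are allowed to have empty parts.
\<close>

definition covered_triple ::
  "nat \<Rightarrow> nat \<Rightarrow> real \<Rightarrow> (nat \<Rightarrow> 'a set) \<Rightarrow> (nat set \<Rightarrow> nat \<Rightarrow> 'a set set) \<Rightarrow> 'a set \<Rightarrow> bool" where
  "covered_triple t l \<epsilon>2 Vs P e \<longleftrightarrow>
     (\<exists>x y z. e = {x, y, z} \<and>
       (\<exists>i\<in>{1..t}. \<exists>j\<in>{1..t}. \<exists>k\<in>{1..t}. i \<noteq> j \<and> i \<noteq> k \<and> j \<noteq> k \<and>
         (\<exists>\<alpha>\<in>{1..l}. \<exists>\<beta>\<in>{1..l}. \<exists>\<gamma>\<in>{1..l}.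
            {x, y} \<in> P {i, j} \<alpha> \<and> {x, z} \<in> P {i, k} \<beta> \<and> {y, z} \<in> P {j, k} \<gamma> \<and>
            disc2_dens \<epsilon>2 (1 / real l) (Vs i) (Vs j) (P {i, j} \<alpha>) \<and>
            disc2_dens \<epsilon>2 (1 / real l) (Vs i) (Vs k) (P {i, k} \<beta>) \<and>
            disc2_dens \<epsilon>2 (1 / real l) (Vs j) (Vs k) (P {j, k} \<gamma>))))"

definition decomposition ::
  "nat \<Rightarrow> nat \<Rightarrow> real \<Rightarrow> real \<Rightarrow> 'a set \<Rightarrow> (nat \<Rightarrow> 'a set) \<Rightarrow> (nat set \<Rightarrow> nat \<Rightarrow> 'a set set) \<Rightarrow> bool"
where
  "decomposition t l \<epsilon>1 \<epsilon>2 V Vs P \<longleftrightarrow>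
     V = (\<Union>i\<in>{1..t}. Vs i) \<and> disjoint_family_on Vs {1..t} \<and>
     (\<forall>i\<in>{1..t}. \<forall>j\<in>{1..t}. i \<le> j \<longrightarrow> card (Vs i) \<le> card (Vs j)) \<and>
     card (Vs t) \<le> card (Vs 1) + 1 \<and>
     (\<forall>i\<in>{1..t}. \<forall>j\<in>{1..t}. i \<noteq> j \<longrightarrow>
        K2 (Vs i) (Vs j) = (\<Union>\<alpha>\<in>{1..l}. P {i, j} \<alpha>) \<and>
        disjoint_family_on (P {i, j}) {1..l}) \<and>
     real (card {e \<in> [V]\<^bsup>3\<^esup>. \<not> covered_triple t l \<epsilon>2 Vs P e}) \<le> \<epsilon>1 * real (card V) ^ 3"

definition triad ::
  "(nat \<Rightarrow> 'a set) \<Rightarrow> (nat set \<Rightarrow> nat \<Rightarrow> 'a set set) \<Rightarrow>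
     nat \<Rightarrow> nat \<Rightarrow> nat \<Rightarrow> nat \<Rightarrow> nat \<Rightarrow> nat \<Rightarrow> 'a hgraph" where
  "triad Vs P i j k \<alpha> \<beta> \<gamma> =
     (Vs i \<union> Vs j \<union> Vs k, P {i, j} \<alpha> \<union> P {i, k} \<beta> \<union> P {j, k} \<gamma>)"

definition triad_disc23 ::
  "real \<Rightarrow> real \<Rightarrow> 'a hgraph \<Rightarrow> (nat \<Rightarrow> 'a set) \<Rightarrow> (nat set \<Rightarrow> nat \<Rightarrow> 'a set set) \<Rightarrow>
     nat \<Rightarrow> nat \<Rightarrow> nat \<Rightarrow> nat \<Rightarrow> nat \<Rightarrow> nat \<Rightarrow> bool" where
  "triad_disc23 \<epsilon>1 \<epsilon>2 H Vs P i j k \<alpha> \<beta> \<gamma> \<longleftrightarrow>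
     (let G = triad Vs P i j k \<alpha> \<beta> \<gamma>
      in disc23 \<epsilon>1 \<epsilon>2 (Vs i) (Vs j) (Vs k) (hverts G, hedges H \<inter> K3 G) G)"

definition admits_binary_disc23_error :: "nat hgraph set \<Rightarrow> bool" where
  "admits_binary_disc23_error \<H> \<longleftrightarrow>
     (\<forall>t0\<ge>1. \<forall>l0\<ge>1. \<forall>\<epsilon>1>0. \<forall>\<epsilon>2 :: nat \<Rightarrow> real. (\<forall>m. 0 < \<epsilon>2 m \<and> \<epsilon>2 m \<le> 1) \<longrightarrow>
       (\<exists>N T L :: nat. \<forall>H\<in>\<H>. N \<le> card (hverts H) \<longrightarrow>
         (\<exists>t l Vs P \<Gamma>. t0 \<le> t \<and> t \<le> T \<and> l0 \<le> l \<and> l \<le> L \<and>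
            decomposition t l \<epsilon>1 (\<epsilon>2 l) (hverts H) Vs P \<and>
            \<Gamma> \<subseteq> [{1..t}]\<^bsup>2\<^esup> \<and> real (card \<Gamma>) \<le> \<epsilon>1 * real t ^ 2 \<and>
            (\<forall>i\<in>{1..t}. \<forall>j\<in>{1..t}. \<forall>k\<in>{1..t}. i \<noteq> j \<and> i \<noteq> k \<and> j \<noteq> k \<and>
               {i, j} \<notin> \<Gamma> \<and> {i, k} \<notin> \<Gamma> \<and> {j, k} \<notin> \<Gamma> \<longrightarrow>
               (\<forall>\<alpha>\<in>{1..l}. \<forall>\<beta>\<in>{1..l}. \<forall>\<gamma>\<in>{1..l}.
                  triad_disc23 \<epsilon>1 (\<epsilon>2 l) H Vs P i j k \<alpha> \<beta> \<gamma>)))))"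

definition requires_nonbinary_disc23_error :: "nat hgraph set \<Rightarrow> bool" where
  "requires_nonbinary_disc23_error \<H> \<longleftrightarrow> \<not> admits_binary_disc23_error \<H>"

end

theory Submission
  imports Defs
begin

text \<open>
  The random-like bipartite graphs of a decomposition cannot separate vertices inside a part, so by
  triangle counting a regular triad on parts \<open>V\<^sub>i, V\<^sub>j, V\<^sub>k\<close> admits no large \<open>X, X' \<subseteq> V\<^sub>i\<close>,
  \<open>Y \<subseteq> V\<^sub>j\<close>, \<open>Z \<subseteq> V\<^sub>k\<close> for which all triples in \<open>X \<times> Y \<times> Z\<close> are edges and none in \<open>X' \<times> Y \<times> Z\<close> is.
  Such sets are produced as follows.  Regard \<open>F\<^sub>p\<^sup>n\<close> as a \<open>p\<close>-ary tree whose cells are the sets of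
  vectors with a common prefix.  The depth of a part is the first level at which no cell contains
  most of it; say the parts among the \<open>a\<^sub>g\<close> are the first ones to break up.  If \<open>V\<^sub>i\<close> breaks up at depth
  \<open>m\<close>, there is a prefix \<open>s\<close> of length \<open>m\<close> such that, for \<open>g' + g'' = -s\<close> on the first \<open>m\<close> coordinates,
  many \<open>g \<in> V\<^sub>i\<close> have a sum \<open>g + g' + g''\<close> that is decided within the first \<open>m\<close> coordinates to be in
  \<open>A(p,n)\<close>, and many have a sum that is so decided to be outside.  It remains to find a random triple
  \<open>(g, g', g'')\<close> of this kind that avoids the exceptional pairs \<open>\<Gamma>\<close>: the pairs \<open>(g, g')\<close> and
  \<open>(g, g'')\<close> are uniformly distributed, and the density of \<open>(g', g'')\<close> is bounded in \<open>L\<^sup>2\<close>, because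
  parts whose prefixes extend a given one are concentrated on a single cell.
\<close>

section \<open>Triangle counting\<close>

lemma doubleton_in_K2: "{x, y} \<in> K2 X Y \<longleftrightarrow> x \<noteq> y \<and> (x \<in> X \<and> y \<in> Y \<or> x \<in> Y \<and> y \<in> X)"
  by (auto simp: K2_def doubleton_eq_iff)

lemma K2_mono: "U \<subseteq> X \<Longrightarrow> W \<subseteq> Y \<Longrightarrow> K2 U W \<subseteq> K2 X Y"
  by (fastforce simp: K2_def)

lemma card_Int_K2:
  assumes "finite U" "finite W" "U \<inter> W = {}"
  shows "card (E \<inter> K2 U W) = (\<Sum>u\<in>U. card {w \<in> W. {u, w} \<in> E})"
proof -
  have "bij_betw (\<lambda>(u, w). {u, w}) (SIGMA u:U. {w \<in> W. {u, w} \<in> E}) (E \<inter> K2 U W)"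
  proof (rule bij_betw_imageI)
    show "inj_on (\<lambda>(u, w). {u, w}) (SIGMA u:U. {w \<in> W. {u, w} \<in> E})"
      using assms(3) by (auto simp: inj_on_def doubleton_eq_iff)
    show "(\<lambda>(u, w). {u, w}) ` (SIGMA u:U. {w \<in> W. {u, w} \<in> E}) = E \<inter> K2 U W"
    proof
      show "(\<lambda>(u, w). {u, w}) ` (SIGMA u:U. {w \<in> W. {u, w} \<in> E}) \<subseteq> E \<inter> K2 U W"
        using assms(3) by (auto simp: doubleton_in_K2)
      show "E \<inter> K2 U W \<subseteq> (\<lambda>(u, w). {u, w}) ` (SIGMA u:U. {w \<in> W. {u, w} \<in> E})"
        unfolding K2_def by force
    qed
  qed
  from bij_betw_same_card[OF this] show ?thesis
    using assms by (simp add: card_SigmaI)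
qed

text \<open>The low-degree vertices \<open>?L\<close> miss at least
  \<open>d / 4 * |?L| * |Y|\<close> of the edges expected towards \<open>Y\<close>. By
  \<open>disc\<close> this makes \<open>|?L|\<close> at most
  \<open>4 * \<epsilon> / (d * \<delta>\<^sup>2)\<close> times \<open>|X|\<close>, and
  \<open>small\<close> turns the factor into a quarter.\<close>

lemma low_degree_bound:
  fixes d \<epsilon> \<delta> :: real
  assumes fin: "finite V1" "finite V2" "V1 \<inter> V2 = {}" and ne: "card V2 > 0"
    and disc: "\<And>U W. U \<subseteq> V1 \<Longrightarrow> W \<subseteq> V2 \<Longrightarrow>
      \<bar>real (card (E \<inter> K2 U W)) - d * real (card U) * real (card W)\<bar> \<le> \<epsilon> * real (card V1) * real (card V2)"
    and X: "X \<subseteq> V1" "\<delta> * real (card V1) \<le> real (card X)"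
    and Y: "Y \<subseteq> V2" "\<delta> * real (card V2) \<le> real (card Y)"
    and pos: "0 < \<delta>" "0 < d" "0 \<le> \<epsilon>" and small: "16 * \<epsilon> \<le> d * \<delta>\<^sup>2"
  shows "real (card {x \<in> X. real (card {y \<in> Y. {x, y} \<in> E}) < 3/4 * d * real (card Y)}) \<le> real (card X) / 4"
    (is "real (card ?L) \<le> _")
proof -
  have finX: "finite X" "finite Y" using X Y fin finite_subset by blast+
  have "real (card (E \<inter> K2 ?L Y)) = (\<Sum>u\<in>?L. real (card {w \<in> Y. {u, w} \<in> E}))"
    by (subst card_Int_K2) (use finX fin X Y in auto)
  also have "\<dots> \<le> (\<Sum>u\<in>?L. 3/4 * d * real (card Y))"
    by (rule sum_mono) auto
  finally have up: "real (card (E \<inter> K2 ?L Y)) \<le> real (card ?L) * (3/4 * d * real (card Y))"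
    by simp
  have "\<bar>real (card (E \<inter> K2 ?L Y)) - d * real (card ?L) * real (card Y)\<bar>
      \<le> \<epsilon> * real (card V1) * real (card V2)"
    using X Y by (intro disc) auto
  hence 1: "d / 4 * real (card ?L) * real (card Y) \<le> \<epsilon> * real (card V1) * real (card V2)"
    using up by (simp add: algebra_simps abs_le_iff)
  have "d / 4 * real (card ?L) * (\<delta> * real (card V2)) * \<delta>
      \<le> d / 4 * real (card ?L) * real (card Y) * \<delta>"
    using Y pos by (intro mult_left_mono mult_right_mono) auto
  also have "\<dots> \<le> \<epsilon> * real (card V1) * real (card V2) * \<delta>"
    using 1 pos by (intro mult_right_mono) auto
  also have "\<dots> = \<epsilon> * (\<delta> * real (card V1)) * real (card V2)" by simp
  also have "\<dots> \<le> \<epsilon> * real (card X) * real (card V2)"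
    using X pos by (intro mult_left_mono mult_right_mono) auto
  also have "\<dots> \<le> (d * \<delta>\<^sup>2 / 16) * real (card X) * real (card V2)"
    using small by (intro mult_right_mono) auto
  finally have "(d * \<delta>\<^sup>2 * real (card V2) / 4) * real (card ?L)
      \<le> (d * \<delta>\<^sup>2 * real (card V2) / 4) * (real (card X) / 4)"
    by (simp add: power2_eq_square algebra_simps)
  thus ?thesis
    using pos ne by (subst (asm) mult_le_cancel_left_pos) auto
qed

text \<open>At least half of the \<open>x\<close> in \<open>X\<close> have at least 3/4 of the
  expected degree into both \<open>Y\<close> and \<open>Z\<close>. The neighbourhoods of such an
  \<open>x\<close> span at least 9/16 - 1/16 = 1/2 of \<open>d ^ 3 * |Y| * |Z|\<close> edges, each
  of which closes a triangle.\<close>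

lemma triangle_counting:
  fixes d \<epsilon> \<delta> :: real
  assumes fin: "finite V1" "finite V2" "finite V3"
    and disj: "V1 \<inter> V2 = {}" "V1 \<inter> V3 = {}" "V2 \<inter> V3 = {}"
    and ne: "card V2 > 0" "card V3 > 0"
    and disc12: "\<And>U W. U \<subseteq> V1 \<Longrightarrow> W \<subseteq> V2 \<Longrightarrow>
      \<bar>real (card (E \<inter> K2 U W)) - d * real (card U) * real (card W)\<bar> \<le> \<epsilon> * real (card V1) * real (card V2)"
    and disc13: "\<And>U W. U \<subseteq> V1 \<Longrightarrow> W \<subseteq> V3 \<Longrightarrow>
      \<bar>real (card (E \<inter> K2 U W)) - d * real (card U) * real (card W)\<bar> \<le> \<epsilon> * real (card V1) * real (card V3)"
    and disc23: "\<And>U W. U \<subseteq> V2 \<Longrightarrow> W \<subseteq> V3 \<Longrightarrow>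
      \<bar>real (card (E \<inter> K2 U W)) - d * real (card U) * real (card W)\<bar> \<le> \<epsilon> * real (card V2) * real (card V3)"
    and X: "X \<subseteq> V1" "\<delta> * real (card V1) \<le> real (card X)"
    and Y: "Y \<subseteq> V2" "\<delta> * real (card V2) \<le> real (card Y)"
    and Z: "Z \<subseteq> V3" "\<delta> * real (card V3) \<le> real (card Z)"
    and pos: "0 < \<delta>" "0 < d" "d \<le> 1" "0 \<le> \<epsilon>" and small: "16 * \<epsilon> \<le> d ^ 3 * \<delta>\<^sup>2"
  shows "d ^ 3 * real (card X) * real (card Y) * real (card Z) / 4
    \<le> real (card {(x, y, z) \<in> X \<times> Y \<times> Z. {x, y} \<in> E \<and> {x, z} \<in> E \<and> {y, z} \<in> E})"
proof -
  have finX: "finite X" "finite Y" "finite Z" using X Y Z fin finite_subset by blast+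
  have small1: "16 * \<epsilon> \<le> d * \<delta>\<^sup>2"
  proof -
    have "d ^ 3 \<le> d ^ 1" using pos by (intro power_decreasing) auto
    hence "d ^ 3 * \<delta>\<^sup>2 \<le> d * \<delta>\<^sup>2" by (intro mult_right_mono) auto
    thus ?thesis using small by linarith
  qed
  define NY where "NY x = {y \<in> Y. {x, y} \<in> E}" for x
  define NZ where "NZ x = {z \<in> Z. {x, z} \<in> E}" for x
  define LY where "LY = {x \<in> X. real (card (NY x)) < 3/4 * d * real (card Y)}"
  define LZ where "LZ = {x \<in> X. real (card (NZ x)) < 3/4 * d * real (card Z)}"
  define R where "R = X - (LY \<union> LZ)"
  define c where "c = d ^ 3 * real (card Y) * real (card Z) / 2"
  have LY: "real (card LY) \<le> real (card X) / 4"
    unfolding LY_def NY_def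
    by (rule low_degree_bound[OF fin(1,2) disj(1) ne(1) disc12 X Y pos(1,2,4) small1])
  have LZ: "real (card LZ) \<le> real (card X) / 4"
    unfolding LZ_def NZ_def
    by (rule low_degree_bound[OF fin(1,3) disj(2) ne(2) disc13 X Z pos(1,2,4) small1])
  have sub: "LY \<union> LZ \<subseteq> X" "R \<subseteq> X" unfolding LY_def LZ_def R_def by auto
  have "card R = card X - card (LY \<union> LZ)"
    unfolding R_def using sub finX by (intro card_Diff_subset) (auto intro: finite_subset)
  moreover have "card (LY \<union> LZ) \<le> card X" using sub finX by (intro card_mono) auto
  ultimately have R: "real (card X) / 2 \<le> real (card R)"
    using card_Un_le[of LY LZ] LY LZ by linarith
  have err: "\<epsilon> * real (card V2) * real (card V3) \<le> d ^ 3 * real (card Y) * real (card Z) / 16"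
  proof -
    have "16 * (\<epsilon> * real (card V2) * real (card V3)) \<le> d ^ 3 * \<delta>\<^sup>2 * (real (card V2) * real (card V3))"
      using small by (simp add: mult_right_mono flip: mult.assoc)
    also have "\<dots> = d ^ 3 * ((\<delta> * real (card V2)) * (\<delta> * real (card V3)))"
      by (simp add: power2_eq_square)
    also have "\<dots> \<le> d ^ 3 * (real (card Y) * real (card Z))"
      using Y Z pos by (intro mult_left_mono mult_mono) auto
    finally show ?thesis by simp
  qed
  have each: "c \<le> real (card {(y, z) \<in> NY x \<times> NZ x. {y, z} \<in> E})" if "x \<in> R" for x
  proof -
    have deg: "3/4 * d * real (card Y) \<le> real (card (NY x))" "3/4 * d * real (card Z) \<le> real (card (NZ x))"
      using that unfolding R_def LY_def LZ_def by auto
    have NN: "NY x \<subseteq> V2" "NZ x \<subseteq> V3" unfolding NY_def NZ_def using Y Z by auto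
    have fN: "finite (NY x)" "finite (NZ x)" using NN fin finite_subset by blast+
    have "card (E \<inter> K2 (NY x) (NZ x)) = (\<Sum>y\<in>NY x. card {z \<in> NZ x. {y, z} \<in> E})"
      using fN NN disj by (intro card_Int_K2) auto
    also have "\<dots> = card (SIGMA y:NY x. {z \<in> NZ x. {y, z} \<in> E})"
      using fN by (subst card_SigmaI) auto
    also have "(SIGMA y:NY x. {z \<in> NZ x. {y, z} \<in> E}) = {(y, z) \<in> NY x \<times> NZ x. {y, z} \<in> E}"
      by auto
    finally have eq: "real (card {(y, z) \<in> NY x \<times> NZ x. {y, z} \<in> E}) = real (card (E \<inter> K2 (NY x) (NZ x)))"
      by simp
    have "(3/4 * d * real (card Y)) * (3/4 * d * real (card Z)) \<le> real (card (NY x)) * real (card (NZ x))"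
      using deg pos by (intro mult_mono) auto
    hence "d * ((3/4 * d * real (card Y)) * (3/4 * d * real (card Z))) \<le> d * (real (card (NY x)) * real (card (NZ x)))"
      using pos by (intro mult_left_mono) auto
    hence "9/16 * (d ^ 3 * real (card Y) * real (card Z)) \<le> d * real (card (NY x)) * real (card (NZ x))"
      by (simp add: power3_eq_cube mult_ac)
    with disc23[OF NN] err show ?thesis unfolding eq c_def by linarith
  qed
  have c0: "0 \<le> c" unfolding c_def using pos by simp
  have "d ^ 3 * real (card X) * real (card Y) * real (card Z) / 4 = real (card X) / 2 * c"
    unfolding c_def by simp
  also have "\<dots> \<le> real (card R) * c" using R c0 by (intro mult_right_mono) auto
  also have "\<dots> \<le> (\<Sum>x\<in>R. real (card {(y, z) \<in> NY x \<times> NZ x. {y, z} \<in> E}))"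
    using each by (simp add: sum_bounded_below)
  also have "\<dots> \<le> (\<Sum>x\<in>X. real (card {(y, z) \<in> NY x \<times> NZ x. {y, z} \<in> E}))"
    using finX sub by (intro sum_mono2) auto
  also have "\<dots> = real (card (SIGMA x:X. {(y, z) \<in> NY x \<times> NZ x. {y, z} \<in> E}))"
    using finX by (subst card_SigmaI) (auto intro: finite_subset[of _ "Y \<times> Z"] simp: NY_def NZ_def)
  also have "(SIGMA x:X. {(y, z) \<in> NY x \<times> NZ x. {y, z} \<in> E})
     = {(x, y, z) \<in> X \<times> Y \<times> Z. {x, y} \<in> E \<and> {x, z} \<in> E \<and> {y, z} \<in> E}"
    unfolding NY_def NZ_def by auto
  finally show ?thesis .
qed

section \<open>Regular triads contain no mixed configurations\<close>

lemma disc2_dens_deviation: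
  assumes "disc2_dens \<epsilon> d U W (E \<inter> K2 U W)" "finite U" "finite W" "U' \<subseteq> U" "W' \<subseteq> W"
  shows "\<bar>real (card (E \<inter> K2 U' W')) - d * real (card U') * real (card W')\<bar>
    \<le> 2 * \<epsilon> * real (card U) * real (card W)"
proof -
  obtain d' where d': "real (card (E \<inter> K2 U W)) = d' * real (card U) * real (card W)"
    and dev: "\<bar>real (card (E \<inter> K2 U W \<inter> K2 U' W')) - d' * real (card U') * real (card W')\<bar>
            \<le> \<epsilon> * real (card U) * real (card W)"
    using assms unfolding disc2_dens_def disc2_def by blast
  have "E \<inter> K2 U W \<inter> K2 U' W' = E \<inter> K2 U' W'" using K2_mono[OF assms(4,5)] by blast
  with dev have dev: "\<bar>real (card (E \<inter> K2 U' W')) - d' * real (card U') * real (card W')\<bar>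
            \<le> \<epsilon> * real (card U) * real (card W)" by simp
  have le: "card U' \<le> card U" "card W' \<le> card W" using assms by (auto intro: card_mono)
  \<comment> \<open>\<open>disc2\<close> measures against the actual density \<open>d'\<close>.
    Passing to the prescribed \<open>d\<close> costs a second \<open>\<epsilon>\<close>, the bound
    that \<open>disc2_dens\<close> puts on the difference of the two edge counts.\<close>
  have "\<bar>d' - d\<bar> * real (card U') * real (card W') \<le> \<bar>d' - d\<bar> * real (card U) * real (card W)"
    using le by (intro mult_mono) auto
  also have "\<dots> = \<bar>d' * real (card U) * real (card W) - d * real (card U) * real (card W)\<bar>"
    by (simp add: abs_mult flip: left_diff_distrib)
  also have "\<dots> \<le> \<epsilon> * real (card U) * real (card W)"
    using assms(1) unfolding disc2_dens_def d' by simp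
  finally have "\<bar>d' * real (card U') * real (card W') - d * real (card U') * real (card W')\<bar>
    \<le> \<epsilon> * real (card U) * real (card W)"
    by (simp add: abs_mult flip: left_diff_distrib)
  with dev show ?thesis by linarith
qed

text \<open>These are the test subgraphs that are inserted for \<open>G'\<close> in
  \<open>disc23\<close>.\<close>

definition restrict_parts :: "'a hgraph \<Rightarrow> 'a set \<Rightarrow> 'a set \<Rightarrow> 'a set \<Rightarrow> 'a hgraph" where
  "restrict_parts G X Y Z = (hverts G, hedges G \<inter> (K2 X Y \<union> K2 X Z \<union> K2 Y Z))"

lemma subgraph2_restrict_parts: "graph2 G \<Longrightarrow> subgraph2 (restrict_parts G X Y Z) G"
  by (auto simp: restrict_parts_def subgraph2_def graph2_def)

text \<open>Edges run only between different ones of three disjoint sets, so a triangle has one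
  vertex in each; what remains is to put its vertices in order.\<close>

lemma K3_restrict_parts:
  assumes "X \<inter> Y = {}" "X \<inter> Z = {}" "Y \<inter> Z = {}"
  shows "K3 (restrict_parts G X Y Z) =
    (\<lambda>(x, y, z). {x, y, z}) `
      {(x, y, z) \<in> X \<times> Y \<times> Z. {x, y} \<in> hedges G \<and> {x, z} \<in> hedges G \<and> {y, z} \<in> hedges G}"
    (is "?L = ?R")
proof
  show "?L \<subseteq> ?R"
  proof
    fix e assume "e \<in> ?L"
    then obtain x y z where e: "e = {x, y, z}" and ne: "x \<noteq> y" "x \<noteq> z" "y \<noteq> z"
      and "{x, y} \<in> hedges (restrict_parts G X Y Z)" "{x, z} \<in> hedges (restrict_parts G X Y Z)"
        "{y, z} \<in> hedges (restrict_parts G X Y Z)"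
      unfolding K3_def by blast
    hence G: "{x, y} \<in> hedges G" "{x, z} \<in> hedges G" "{y, z} \<in> hedges G"
      and K: "{x, y} \<in> K2 X Y \<union> K2 X Z \<union> K2 Y Z" "{x, z} \<in> K2 X Y \<union> K2 X Z \<union> K2 Y Z"
        "{y, z} \<in> K2 X Y \<union> K2 X Z \<union> K2 Y Z"
      unfolding restrict_parts_def by auto
    have G': "{y, x} \<in> hedges G" "{z, x} \<in> hedges G" "{z, y} \<in> hedges G"
      using G by (simp_all add: insert_commute)
    have "x \<in> X \<and> y \<in> Y \<and> z \<in> Z \<or> x \<in> X \<and> z \<in> Y \<and> y \<in> Z \<or> y \<in> X \<and> x \<in> Y \<and> z \<in> Z \<or>
      y \<in> X \<and> z \<in> Y \<and> x \<in> Z \<or> z \<in> X \<and> x \<in> Y \<and> y \<in> Z \<or> z \<in> X \<and> y \<in> Y \<and> x \<in> Z"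
      using K assms unfolding Un_iff doubleton_in_K2 by blast
    then obtain x' y' z' where "x' \<in> X" "y' \<in> Y" "z' \<in> Z" "e = {x', y', z'}"
      "{x', y'} \<in> hedges G" "{x', z'} \<in> hedges G" "{y', z'} \<in> hedges G"
      unfolding e using G G' by (elim disjE conjE) blast+
    thus "e \<in> ?R" by force
  qed
  show "?R \<subseteq> ?L"
  proof
    fix e assume "e \<in> ?R"
    then obtain x y z where "x \<in> X" "y \<in> Y" "z \<in> Z" "e = {x, y, z}"
      "{x, y} \<in> hedges G" "{x, z} \<in> hedges G" "{y, z} \<in> hedges G" by auto
    moreover from this have "x \<noteq> y" "x \<noteq> z" "y \<noteq> z" using assms by auto
    ultimately show "e \<in> ?L"
      unfolding K3_def restrict_parts_def by (auto simp: doubleton_in_K2)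
  qed
qed

lemma card_K3_restrict_parts:
  assumes "X \<inter> Y = {}" "X \<inter> Z = {}" "Y \<inter> Z = {}"
  shows "card (K3 (restrict_parts G X Y Z)) =
    card {(x, y, z) \<in> X \<times> Y \<times> Z. {x, y} \<in> hedges G \<and> {x, z} \<in> hedges G \<and> {y, z} \<in> hedges G}"
proof -
  have "x = x' \<and> y = y' \<and> z = z'"
    if "{x, y, z} = {x', y', z'}" "x \<in> X" "x' \<in> X" "y \<in> Y" "y' \<in> Y" "z \<in> Z" "z' \<in> Z" for x y z x' y' z'
  proof -
    have "x \<in> {x', y', z'}" "y \<in> {x', y', z'}" "z \<in> {x', y', z'}" using that(1) by blast+
    thus ?thesis using that(2-) assms by blast
  qed
  thus ?thesis
    unfolding K3_restrict_parts[OF assms] by (intro card_image) (auto simp: inj_on_def)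
qed

text \<open>Triangle counting finds many triangles on \<open>X, Y, Z\<close> and on
  \<open>X', Y, Z\<close>. All of the former are edges and none of the latter are, so regularity
  forces both \<open>1 - d3 < 1 / 2\<close> and \<open>d3 < 1 / 2\<close>.\<close>

lemma disc23_not_mixed:
  fixes \<delta> \<epsilon>1 \<epsilon>2 :: real and l :: nat
  assumes disc: "disc23 \<epsilon>1 \<epsilon>2 V1 V2 V3 (S, F \<inter> K3 G) G" and G: "graph2 G"
    and fin: "finite V1" "finite V2" "finite V3"
    and disj: "V1 \<inter> V2 = {}" "V1 \<inter> V3 = {}" "V2 \<inter> V3 = {}"
    and ne: "card V1 > 0" "card V2 > 0" "card V3 > 0"
    and l: "l \<ge> 1" and dens: "card V1 * card V2 \<le> l * card (hedges G \<inter> K2 V1 V2)"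
    and X: "X \<subseteq> V1" "\<delta> * real (card V1) \<le> real (card X)"
    and X': "X' \<subseteq> V1" "\<delta> * real (card V1) \<le> real (card X')"
    and Y: "Y \<subseteq> V2" "\<delta> * real (card V2) \<le> real (card Y)"
    and Z: "Z \<subseteq> V3" "\<delta> * real (card V3) \<le> real (card Z)"
    and \<delta>: "0 < \<delta>" "\<delta> \<le> 1" and \<epsilon>: "16 * \<epsilon>1 < \<delta> ^ 3" "0 \<le> \<epsilon>2" "256 * \<epsilon>2 * real l ^ 3 \<le> \<delta>\<^sup>2"
    and edge: "\<And>x y z. x \<in> X \<Longrightarrow> y \<in> Y \<Longrightarrow> z \<in> Z \<Longrightarrow> {x, y, z} \<in> F"
    and nonedge: "\<And>x y z. x \<in> X' \<Longrightarrow> y \<in> Y \<Longrightarrow> z \<in> Z \<Longrightarrow> {x, y, z} \<notin> F"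
  shows False
proof -
  let ?v = "real (card V1) * real (card V2) * real (card V3)"
  obtain d3 d2 where d2: "0 < d2" "d2 \<le> 1"
    and D12: "disc2_dens \<epsilon>2 d2 V1 V2 (hedges G \<inter> K2 V1 V2)"
    and D13: "disc2_dens \<epsilon>2 d2 V1 V3 (hedges G \<inter> K2 V1 V3)"
    and D23: "disc2_dens \<epsilon>2 d2 V2 V3 (hedges G \<inter> K2 V2 V3)"
    and dev: "\<And>G'. subgraph2 G' G \<Longrightarrow>
             \<bar>real (card (F \<inter> K3 G \<inter> K3 G')) - d3 * real (card (K3 G'))\<bar>
               \<le> \<epsilon>1 * d2 ^ 3 * real (card V1) * real (card V2) * real (card V3)"
    using disc unfolding disc23_def by auto
  have l0: "real l > 0" using l by simp
  have "real l ^ 1 \<le> real l ^ 3" using l by (intro power_increasing) auto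
  hence "256 * \<epsilon>2 * real l \<le> 256 * \<epsilon>2 * real l ^ 3" using \<epsilon> by (intro mult_left_mono) auto
  also have "\<dots> \<le> 1" using \<epsilon> power_le_one[of \<delta> 2] \<delta> by linarith
  finally have e1: "2 * \<epsilon>2 * real l \<le> 1" by simp
  \<comment> \<open>\<open>disc23\<close> leaves \<open>d2\<close> free and possibly tiny. The
    hypothesis \<open>dens\<close> bounds it from below, which makes \<open>\<epsilon>2\<close>
    small compared with \<open>d2 ^ 3\<close>.\<close>
  have "1 / (2 * real l) \<le> d2"
  proof -
    let ?w = "real (card V1) * real (card V2)"
    have w: "?w > 0" using ne by simp
    have "real (card (hedges G \<inter> K2 V1 V2)) \<le> (d2 + \<epsilon>2) * ?w"
      using D12 unfolding disc2_dens_def by (simp add: algebra_simps abs_le_iff)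
    hence "real l * real (card (hedges G \<inter> K2 V1 V2)) \<le> real l * ((d2 + \<epsilon>2) * ?w)"
      by (intro mult_left_mono) auto
    moreover have "?w \<le> real l * real (card (hedges G \<inter> K2 V1 V2))"
      using dens by (simp flip: of_nat_mult)
    ultimately have "1 * ?w \<le> (real l * (d2 + \<epsilon>2)) * ?w" by (simp add: mult.assoc)
    hence "1 \<le> real l * (d2 + \<epsilon>2)" using w by (subst (asm) mult_le_cancel_right_pos) auto
    hence "1 \<le> 2 * real l * d2" using e1 by (simp add: algebra_simps)
    thus ?thesis using l0 by (simp add: field_simps)
  qed
  hence "(1 / (2 * real l)) ^ 3 \<le> d2 ^ 3" by (intro power_mono) auto
  hence "\<delta>\<^sup>2 * (1 / (2 * real l)) ^ 3 \<le> \<delta>\<^sup>2 * d2 ^ 3" by (intro mult_left_mono) auto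
  moreover have "32 * \<epsilon>2 \<le> \<delta>\<^sup>2 * (1 / (2 * real l)) ^ 3"
    using \<epsilon>(3) l0 by (simp add: field_simps)
  ultimately have small: "16 * (2 * \<epsilon>2) \<le> d2 ^ 3 * \<delta>\<^sup>2" by (simp add: mult.commute)
  have count: "d2 ^ 3 * \<delta> ^ 3 * ?v / 4 \<le> real (card (K3 (restrict_parts G W Y Z)))"
    if W: "W \<subseteq> V1" "\<delta> * real (card V1) \<le> real (card W)" for W
  proof -
    have dj: "W \<inter> Y = {}" "W \<inter> Z = {}" "Y \<inter> Z = {}" using disj W Y Z by auto
    have "d2 ^ 3 * \<delta> ^ 3 * ?v / 4
      = d2 ^ 3 * ((\<delta> * real (card V1)) * ((\<delta> * real (card V2)) * (\<delta> * real (card V3)))) / 4"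
      by (simp add: power3_eq_cube mult_ac)
    also have "\<dots> \<le> d2 ^ 3 * (real (card W) * (real (card Y) * real (card Z))) / 4"
      using W Y Z d2 \<delta> by (intro divide_right_mono mult_left_mono mult_mono) auto
    also have "\<dots> = d2 ^ 3 * real (card W) * real (card Y) * real (card Z) / 4"
      by (simp add: mult_ac)
    also have "\<dots> \<le> real (card {(x, y, z) \<in> W \<times> Y \<times> Z. {x, y} \<in> hedges G \<and> {x, z} \<in> hedges G \<and> {y, z} \<in> hedges G})"
      using disc2_dens_deviation[OF D12 fin(1,2)] disc2_dens_deviation[OF D13 fin(1,3)]
        disc2_dens_deviation[OF D23 fin(2,3)]
      by (intro triangle_counting[OF fin disj ne(2,3) _ _ _ W Y Z \<delta>(1) d2 _ small]) (use \<epsilon> in auto)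
    finally show ?thesis unfolding card_K3_restrict_parts[OF dj] .
  qed
  have pos: "0 < d2 ^ 3 * ?v" using d2 ne by simp
  \<comment> \<open>Here \<open>k\<close> is a triangle count and \<open>c\<close> the error in
    density, used with \<open>1 - d3\<close> and with \<open>d3\<close>. If
    \<open>c \<ge> 1 / 2\<close>, the deviation is at least \<open>\<delta> ^ 3 / 8\<close> in units
    of \<open>d2 ^ 3 * ?v\<close>, more than \<open>\<epsilon>1\<close>.\<close>
  have bound: "c < 1 / 2" if c: "c * k \<le> \<epsilon>1 * d2 ^ 3 * real (card V1) * real (card V2) * real (card V3)"
    and k: "d2 ^ 3 * \<delta> ^ 3 * ?v / 4 \<le> k" for c k :: real
  proof (rule ccontr)
    assume "\<not> c < 1 / 2"
    hence "(1 / 2) * (d2 ^ 3 * \<delta> ^ 3 * ?v / 4) \<le> c * k" using k d2 \<delta> by (intro mult_mono) auto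
    with c have "(\<delta> ^ 3 / 8) * (d2 ^ 3 * ?v) \<le> \<epsilon>1 * (d2 ^ 3 * ?v)"
      by (simp add: mult_ac)
    hence "\<delta> ^ 3 / 8 \<le> \<epsilon>1" using pos by (subst (asm) mult_le_cancel_right_pos)
    thus False using \<epsilon>(1) \<delta> zero_less_power[of \<delta> 3] by linarith
  qed
  have dj: "X \<inter> Y = {}" "X \<inter> Z = {}" "Y \<inter> Z = {}" "X' \<inter> Y = {}" "X' \<inter> Z = {}"
    using disj X X' Y Z by auto
  have K3sub: "K3 (restrict_parts G W Y Z) \<subseteq> K3 G" for W
    unfolding K3_def restrict_parts_def by fastforce
  have "K3 (restrict_parts G X Y Z) \<subseteq> F"
    unfolding K3_restrict_parts[OF dj(1-3)] using edge by auto
  hence "F \<inter> K3 G \<inter> K3 (restrict_parts G X Y Z) = K3 (restrict_parts G X Y Z)"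
    using K3sub by blast
  with dev[OF subgraph2_restrict_parts[OF G], of X Y Z]
  have "1 - d3 < 1 / 2" by (intro bound[OF _ count[OF X]]) (simp add: algebra_simps abs_le_iff)
  moreover have "F \<inter> K3 (restrict_parts G X' Y Z) = {}"
    unfolding K3_restrict_parts[OF dj(4,5,3)] using nonedge by auto
  hence "F \<inter> K3 G \<inter> K3 (restrict_parts G X' Y Z) = {}" by blast
  with dev[OF subgraph2_restrict_parts[OF G], of X' Y Z]
  have "d3 < 1 / 2" by (intro bound[OF _ count[OF X']]) (simp add: algebra_simps abs_le_iff)
  ultimately show False by linarith
qed

section \<open>Prefixes and cells\<close>

text \<open>The classes of \<open>agree m\<close> are the cells of level \<open>m\<close>.\<close>

definition agree :: "nat \<Rightarrow> (nat \<Rightarrow> int) \<Rightarrow> (nat \<Rightarrow> int) \<Rightarrow> bool" where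
  "agree m x y \<longleftrightarrow> (\<forall>j\<in>{1..m}. x j = y j)"

definition zero_upto :: "nat \<Rightarrow> nat \<Rightarrow> (nat \<Rightarrow> int) \<Rightarrow> (nat \<Rightarrow> int) \<Rightarrow> (nat \<Rightarrow> int) \<Rightarrow> bool" where
  "zero_upto p m x y z \<longleftrightarrow> (\<forall>j\<in>{1..m}. (x j + y j + z j) mod int p = 0)"

text \<open>Membership in A(p,n) of the sum of three vectors, in integer arithmetic modulo
  \<open>p\<close>; \<open>vec_add_in_GS_A\<close> gives the link to the ring. For
  \<open>i = 1\<close> the prefix condition is empty.\<close>

definition sum_in_A :: "nat \<Rightarrow> nat \<Rightarrow> (nat \<Rightarrow> int) \<Rightarrow> (nat \<Rightarrow> int) \<Rightarrow> (nat \<Rightarrow> int) \<Rightarrow> bool" where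
  "sum_in_A p n x y z \<longleftrightarrow> (\<exists>i\<in>{1..n}. (x i + y i + z i) mod int p = 1 \<and> zero_upto p (i - 1) x y z)"

lemma agree_0 [simp]: "agree 0 x y"
  by (simp add: agree_def)

lemma agree_sym: "agree m x y \<Longrightarrow> agree m y x"
  by (simp add: agree_def)

lemma agree_trans: "agree m x y \<Longrightarrow> agree m y z \<Longrightarrow> agree m x z"
  by (simp add: agree_def)

lemma agree_mono: "agree m x y \<Longrightarrow> k \<le> m \<Longrightarrow> agree k x y"
  by (auto simp: agree_def)

lemma agree_Suc: "agree (Suc m) x y \<longleftrightarrow> agree m x y \<and> x (Suc m) = y (Suc m)"
  by (auto simp: agree_def le_Suc_eq)

lemma F_vecs_eq: "F_vecs p n = {1..n} \<rightarrow>\<^sub>E {0..<int p}"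
  by (auto simp: F_vecs_def residue_ring_def PiE_def Pi_def)

lemma finite_F_vecs [simp]: "finite (F_vecs p n)"
  unfolding F_vecs_eq by (intro finite_PiE) auto

lemma F_vecs_range: "x \<in> F_vecs p n \<Longrightarrow> i \<in> {1..n} \<Longrightarrow> 0 \<le> x i \<and> x i < int p"
  unfolding F_vecs_eq by (auto dest: PiE_mem)

lemma F_vecs_eqI: "x \<in> F_vecs p n \<Longrightarrow> y \<in> F_vecs p n \<Longrightarrow> agree n x y \<Longrightarrow> x = y"
  unfolding F_vecs_eq agree_def by (rule PiE_ext) auto

lemma F_vecs_upd: "x \<in> F_vecs p n \<Longrightarrow> i \<in> {1..n} \<Longrightarrow> 0 \<le> c \<Longrightarrow> c < int p \<Longrightarrow> x(i := c) \<in> F_vecs p n"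
  unfolding F_vecs_eq by (auto simp: PiE_def extensional_def)

lemma card_prefix:
  assumes "m \<le> n" "\<And>j. j \<in> {1..m} \<Longrightarrow> 0 \<le> c j \<and> c j < int p"
  shows "card {z \<in> F_vecs p n. \<forall>j\<in>{1..m}. z j = c j} = p ^ (n - m)"
proof -
  let ?B = "\<lambda>j. if j \<in> {1..m} then {c j} else {0..<int p}"
  have "{z \<in> F_vecs p n. \<forall>j\<in>{1..m}. z j = c j} = PiE {1..n} ?B"
  proof (intro equalityI subsetI)
    fix z assume "z \<in> {z \<in> F_vecs p n. \<forall>j\<in>{1..m}. z j = c j}"
    thus "z \<in> PiE {1..n} ?B" unfolding F_vecs_eq by (auto simp: PiE_iff)
  next
    fix z assume z: "z \<in> PiE {1..n} ?B"
    have mem: "z j \<in> ?B j" if "j \<in> {1..n}" for j using z that by (rule PiE_mem)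
    have "z j = c j" if "j \<in> {1..m}" for j using mem[of j] that assms(1) by simp
    moreover have "z j \<in> {0..<int p}" if "j \<in> {1..n}" for j
      using mem[OF that] assms(2)[of j] by (cases "j \<in> {1..m}") auto
    moreover have "z \<in> extensional {1..n}" using z by (simp add: PiE_def)
    ultimately show "z \<in> {z \<in> F_vecs p n. \<forall>j\<in>{1..m}. z j = c j}"
      unfolding F_vecs_eq by (auto simp: PiE_iff)
  qed
  also have "card \<dots> = (\<Prod>j\<in>{1..n}. card (?B j))" by (rule card_PiE) simp
  also have "{1..n} = {1..m} \<union> {Suc m..n}" using assms by auto
  also have "(\<Prod>j\<in>\<dots>. card (?B j)) = (\<Prod>j\<in>{1..m}. card (?B j)) * (\<Prod>j\<in>{Suc m..n}. card (?B j))"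
    by (rule prod.union_disjoint) auto
  also have "(\<Prod>j\<in>{1..m}. card (?B j)) = 1" by simp
  also have "(\<Prod>j\<in>{Suc m..n}. card (?B j)) = (\<Prod>j\<in>{Suc m..n}. p)"
    by (rule prod.cong) auto
  finally show ?thesis by simp
qed

lemma card_F_vecs: "card (F_vecs p n) = p ^ n"
  using card_prefix[of 0 n] by simp

lemma card_agree:
  assumes "x \<in> F_vecs p n" "m \<le> n"
  shows "card {y \<in> F_vecs p n. agree m x y} = p ^ (n - m)"
proof -
  have "{y \<in> F_vecs p n. agree m x y} = {y \<in> F_vecs p n. \<forall>j\<in>{1..m}. y j = x j}"
    by (auto simp: agree_def)
  moreover have "card \<dots> = p ^ (n - m)" using assms F_vecs_range[OF assms(1)] by (intro card_prefix) auto
  ultimately show ?thesis by simp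
qed

text \<open>The first \<open>m\<close> coordinates of \<open>z\<close> are forced and the others are
  free. That the count does not depend on \<open>x\<close> and \<open>y\<close> is what makes the
  random pairs \<open>(g, g')\<close> and \<open>(g, g'')\<close> uniform later.\<close>

lemma card_zero_upto:
  assumes "p \<ge> 1" "m \<le> n"
  shows "card {z \<in> F_vecs p n. zero_upto p m x y z} = p ^ (n - m)"
proof -
  have *: "(x j + y j + z j) mod int p = 0 \<longleftrightarrow> z j = (- x j - y j) mod int p"
    if "z \<in> F_vecs p n" "j \<in> {1..m}" for z j
  proof -
    have "0 \<le> z j" "z j < int p" using F_vecs_range[OF that(1), of j] that(2) assms(2) by auto
    hence "z j = z j mod int p" by simp
    hence "z j = (- x j - y j) mod int p \<longleftrightarrow> z j mod int p = (- x j - y j) mod int p" by simp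
    also have "\<dots> \<longleftrightarrow> (x j + y j + z j) mod int p = 0"
      by (simp add: mod_eq_dvd_iff algebra_simps dvd_eq_mod_eq_0)
    finally show ?thesis by simp
  qed
  have "{z \<in> F_vecs p n. zero_upto p m x y z} = {z \<in> F_vecs p n. \<forall>j\<in>{1..m}. z j = (- x j - y j) mod int p}"
    using * unfolding zero_upto_def by blast
  moreover have "card \<dots> = p ^ (n - m)" using assms by (intro card_prefix) auto
  ultimately show ?thesis by simp
qed

lemma zero_upto_commute: "zero_upto p m x y z \<longleftrightarrow> zero_upto p m x z y"
  by (simp add: zero_upto_def add_ac)

text \<open>Both vectors are congruent to \<open>- y - z\<close> on the first \<open>m\<close>
  coordinates, and residues are reduced. Hence two targets compete for the same pair only if their
  cells are nested.\<close>

lemma zero_upto_agree: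
  assumes "zero_upto p m x y z" "zero_upto p k x' y z" "m \<le> k" "k \<le> n"
    and "x \<in> F_vecs p n" "x' \<in> F_vecs p n"
  shows "agree m x x'"
  unfolding agree_def
proof
  fix j assume j: "j \<in> {1..m}"
  have "int p dvd (x j + y j + z j) - (x' j + y j + z j)"
    using assms j unfolding zero_upto_def by (intro dvd_diff) auto
  hence "x j mod int p = x' j mod int p" by (simp add: mod_eq_dvd_iff)
  thus "x j = x' j" using F_vecs_range[OF assms(5), of j] F_vecs_range[OF assms(6), of j] j assms(3,4) by simp
qed

text \<open>Summation over the fibres of \<open>f\<close>; it turns a proportion valid in each part
  into a proportion of a union of parts.\<close>

lemma card_class_transfer:
  fixes \<alpha> \<beta> :: nat
  assumes "finite T" "D \<subseteq> T"
    and "\<And>i. i \<in> f ` T \<Longrightarrow> \<alpha> * card {x \<in> T. f x = i} \<le> \<beta> * card {x \<in> D. f x = i}"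
  shows "\<alpha> * card T \<le> \<beta> * card D"
proof -
  have fib: "card S = (\<Sum>i\<in>f ` T. card {x \<in> S. f x = i})" if "S \<subseteq> T" for S
    using sum.group[OF finite_subset[OF that assms(1)] finite_imageI[OF assms(1)] image_mono[OF that, of f],
        of "\<lambda>_. 1::nat"] by simp
  have "\<alpha> * card T = (\<Sum>i\<in>f ` T. \<alpha> * card {x \<in> T. f x = i})"
    using fib[of T] by (simp add: sum_distrib_left)
  also have "\<dots> \<le> (\<Sum>i\<in>f ` T. \<beta> * card {x \<in> D. f x = i})" by (intro sum_mono assms)
  also have "\<dots> = \<beta> * card D" using fib[OF assms(2)] by (simp add: sum_distrib_left)
  finally show ?thesis .
qed

section \<open>Concentration of parts on cells\<close>

text \<open>
  A colouring \<open>f\<close> of the vectors assigns to each of them the index of its part; \<open>v i\<close> is the size of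
  the \<open>i\<close>-th part of the ambient vertex set, which also contains vertices of other kinds.
\<close>

definition conc :: "nat \<Rightarrow> nat \<Rightarrow> nat \<Rightarrow> (nat \<Rightarrow> int) set \<Rightarrow> bool" where
  "conc p n m S \<longleftrightarrow> (\<exists>g\<in>F_vecs p n. 7 * card S < 8 * card {x \<in> S. agree m g x})"

definition cls :: "nat \<Rightarrow> nat \<Rightarrow> ((nat \<Rightarrow> int) \<Rightarrow> nat) \<Rightarrow> (nat \<Rightarrow> int) \<Rightarrow> (nat \<Rightarrow> int) set" where
  "cls p n f g = {x \<in> F_vecs p n. f x = f g}"

text \<open>The factor 48 comes from the part sizes adding up to \<open>3 * p ^ n\<close>: the
  classes that are not heavy then contain at most 3/48 = 1/16 of all vectors.\<close>

definition heavy :: "nat \<Rightarrow> nat \<Rightarrow> (nat \<Rightarrow> nat) \<Rightarrow> ((nat \<Rightarrow> int) \<Rightarrow> nat) \<Rightarrow> (nat \<Rightarrow> int) \<Rightarrow> bool" where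
  "heavy p n v f g \<longleftrightarrow> v (f g) \<le> 48 * card (cls p n f g)"

definition typical :: "nat \<Rightarrow> nat \<Rightarrow> (nat \<Rightarrow> nat) \<Rightarrow> ((nat \<Rightarrow> int) \<Rightarrow> nat) \<Rightarrow> nat \<Rightarrow> (nat \<Rightarrow> int) set" where
  "typical p n v f m = {g \<in> F_vecs p n. heavy p n v f g \<and> conc p n m (cls p n f g)}"

text \<open>A part concentrated on one cell may spread over its \<open>p\<close> children, so a
  share of order \<open>1 / p\<close> in the vector's own cell is the natural demand; the slack 64
  keeps exceptions rare.\<close>

definition good :: "nat \<Rightarrow> nat \<Rightarrow> (nat \<Rightarrow> nat) \<Rightarrow> ((nat \<Rightarrow> int) \<Rightarrow> nat) \<Rightarrow> nat \<Rightarrow> (nat \<Rightarrow> int) \<Rightarrow> bool" where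
  "good p n v f m g \<longleftrightarrow> heavy p n v f g \<and>
     card (cls p n f g) \<le> 64 * p * card {x \<in> cls p n f g. agree m g x}"

text \<open>In all uses 0 is not in \<open>D\<close>, so \<open>i\<close> is the first position
  where \<open>x\<close> leaves \<open>s\<close>. For \<open>D = {1}\<close> the vector
  \<open>x - s\<close> is decided to be in A(p,n) within \<open>m\<close> coordinates, for
  \<open>D = - {0, 1}\<close> it is decided to be outside.\<close>

definition first_diff :: "nat \<Rightarrow> nat \<Rightarrow> (nat \<Rightarrow> int) \<Rightarrow> int set \<Rightarrow> (nat \<Rightarrow> int) set \<Rightarrow> (nat \<Rightarrow> int) set" where
  "first_diff p m s D S = {x \<in> S. \<exists>i\<in>{1..m}. (x i - s i) mod int p \<in> D \<and> agree (i - 1) s x}"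

lemma cls_subset: "cls p n f g \<subseteq> F_vecs p n"
  by (auto simp: cls_def)

lemma finite_cls [simp]: "finite (cls p n f g)"
  by (rule finite_subset[OF cls_subset]) simp

lemma cls_cong: "f x = f g \<Longrightarrow> cls p n f x = cls p n f g"
  by (simp add: cls_def)

lemma heavy_cong: "f x = f g \<Longrightarrow> heavy p n v f x = heavy p n v f g"
  by (simp add: cls_def heavy_def)

text \<open>More than 7/8 of a typical class lies in one cell of level \<open>M - 1\<close>. Its
  children of relative size below \<open>1 / (64 * p)\<close> hold at most 1/64 of the class, so at
  least 7/8 - 1/64 = 55/64 of it is good. Finally 7/8 times 55/64 exceeds 3/4.\<close>

lemma card_not_good:
  assumes p: "p \<ge> 1" and M: "1 \<le> M" "M \<le> n"
    and tp: "7 * p ^ n \<le> 8 * card (typical p n v f (M - 1))"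
  shows "4 * card {g \<in> F_vecs p n. \<not> good p n v f M g} \<le> p ^ n"
proof -
  define T where "T = typical p n v f (M - 1)"
  define D where "D = {g \<in> T. good p n v f M g}"
  have finT: "finite T" unfolding T_def typical_def by simp
  have "55 * card T \<le> 64 * card D"
  proof (rule card_class_transfer[where f = f])
    fix i assume "i \<in> f ` T"
    then obtain g where g: "g \<in> T" "i = f g" by blast
    define B where "B = cls p n f g"
    define G where "G = {x \<in> B. card B \<le> 64 * p * card {y \<in> B. agree M x y}}"
    have finB: "finite B" unfolding B_def by simp
    have inv: "cls p n f x = B" "heavy p n v f x" if "x \<in> B" for x
      using that g heavy_cong[of f x g p n v] unfolding B_def T_def typical_def by (auto simp: cls_def)
    have T: "{x \<in> T. f x = i} = B"
    proof (intro equalityI subsetI)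
      fix x assume "x \<in> {x \<in> T. f x = i}"
      thus "x \<in> B" unfolding T_def typical_def B_def cls_def g(2) by simp
    next
      fix x assume x: "x \<in> B"
      hence "f x = f g" "x \<in> F_vecs p n" unfolding B_def cls_def by auto
      moreover have "conc p n (M - 1) B" using g unfolding T_def typical_def B_def by simp
      ultimately show "x \<in> {x \<in> T. f x = i}"
        using inv[OF x] unfolding T_def typical_def g(2) by simp
    qed
    have D: "{x \<in> D. f x = i} = G"
    proof -
      have "{x \<in> D. f x = i} = {x \<in> B. good p n v f M x}" unfolding D_def T[symmetric] by auto
      also have "\<dots> = G"
        using inv unfolding G_def good_def by auto
      finally show ?thesis .
    qed
    from g obtain g0 where g0: "7 * card B < 8 * card {x \<in> B. agree (M - 1) g0 x}"
      unfolding T_def typical_def conc_def B_def by auto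
    define Bad where "Bad u = {x \<in> B - G. agree (M - 1) g0 x \<and> x M = u}" for u
    \<comment> \<open>One member suffices: all of \<open>Bad u\<close> lies in its cell of level
      \<open>M\<close>, which is small because that member is outside \<open>G\<close>.\<close>
    have bad: "64 * p * card (Bad u) \<le> card B" for u
    proof (cases "Bad u = {}")
      case False
      then obtain x where x: "x \<in> Bad u" by blast
      have "Bad u \<subseteq> {y \<in> B. agree M x y}"
      proof
        fix y assume y: "y \<in> Bad u"
        have "agree (M - 1) x y"
          using x y agree_trans[OF agree_sym, of "M - 1" g0 x y] unfolding Bad_def by auto
        thus "y \<in> {y \<in> B. agree M x y}"
          using x y M(1) agree_Suc[of "M - 1" x y] unfolding Bad_def by auto
      qed
      hence "card (Bad u) \<le> card {y \<in> B. agree M x y}" using finB by (intro card_mono) auto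
      hence "64 * p * card (Bad u) \<le> 64 * p * card {y \<in> B. agree M x y}" by (intro mult_left_mono) auto
      also have "\<dots> \<le> card B" using x unfolding Bad_def G_def by auto
      finally show ?thesis .
    qed simp
    have "{x \<in> B. agree (M - 1) g0 x} \<subseteq> G \<union> (\<Union>u\<in>{0..<int p}. Bad u)"
      using F_vecs_range[of _ p n M] M unfolding Bad_def B_def cls_def by auto
    hence "card {x \<in> B. agree (M - 1) g0 x} \<le> card (G \<union> (\<Union>u\<in>{0..<int p}. Bad u))"
      using finB by (intro card_mono) (auto simp: G_def Bad_def)
    also have "\<dots> \<le> card G + card (\<Union>u\<in>{0..<int p}. Bad u)" by (rule card_Un_le)
    also have "card (\<Union>u\<in>{0..<int p}. Bad u) \<le> (\<Sum>u\<in>{0..<int p}. card (Bad u))"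
      by (rule card_UN_le) simp
    finally have le: "card {x \<in> B. agree (M - 1) g0 x} \<le> card G + (\<Sum>u\<in>{0..<int p}. card (Bad u))"
      by simp
    have "p * (64 * (\<Sum>u\<in>{0..<int p}. card (Bad u))) = (\<Sum>u\<in>{0..<int p}. 64 * p * card (Bad u))"
      by (simp add: sum_distrib_left mult_ac)
    also have "\<dots> \<le> (\<Sum>u\<in>{0..<int p}. card B)" by (intro sum_mono bad)
    also have "\<dots> = p * card B" by simp
    finally have "64 * (\<Sum>u\<in>{0..<int p}. card (Bad u)) \<le> card B" using p by simp
    with le g0 have "55 * card B \<le> 64 * card G" by linarith
    thus "55 * card {x \<in> T. f x = i} \<le> 64 * card {x \<in> D. f x = i}" unfolding T D .
  qed (auto simp: finT D_def)
  moreover have "card D \<le> card {g \<in> F_vecs p n. good p n v f M g}"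
    by (rule card_mono) (auto simp: D_def T_def typical_def)
  moreover have "card {g \<in> F_vecs p n. good p n v f M g} + card {g \<in> F_vecs p n. \<not> good p n v f M g} = p ^ n"
    unfolding card_F_vecs[symmetric] by (subst card_Un_disjoint[symmetric]) (auto intro: arg_cong[of _ _ card])
  ultimately show ?thesis using tp unfolding T_def by linarith
qed

section \<open>Splitting a part at the level where it breaks up\<close>

lemma mod_shift_cases:
  fixes e q :: int
  assumes "e \<noteq> 0" "- q < e" "e < q" "q \<ge> 3"
  shows "(e + 2) mod q = 1 \<or> (e + 1) mod q \<notin> {0, 1}"
proof -
  \<comment> \<open>Only \<open>e = -1\<close> and \<open>e = q - 1\<close> make
    \<open>e + 1\<close> congruent to 0 or 1, and for these \<open>e + 2\<close> is congruent to
    1.\<close>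
  consider "e = -1" | "e = q - 1" | "0 < e" "e + 1 < q" | "e < -1" using assms by linarith
  thus ?thesis
  proof cases
    case 2
    hence "e + 2 = 1 + q" by simp
    hence "(e + 2) mod q = 1 mod q" by (simp only: mod_add_self2)
    thus ?thesis using assms by simp
  next
    case 4
    have "(e + 1) mod q = (e + 1 + q) mod q" by simp
    also have "\<dots> = e + 1 + q" using 4 assms by (intro mod_pos_pos_trivial) auto
    finally show ?thesis using assms by simp
  qed (use assms in auto)
qed

text \<open>
  The target \<open>s\<close> extends the prefix of \<open>g\<close> by one coordinate.  With \<open>u\<close> the most popular next
  coordinate, both \<open>u - 1\<close> and \<open>u - 2\<close> put all of \<open>u\<close> on one side, and every point of \<open>S\<close> outside
  that child falls on the other side for at least one of the two choices.
\<close>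

lemma split_target:
  assumes p: "p \<ge> 3" and S: "S \<subseteq> F_vecs p n" "S \<noteq> {}" and m: "m < n" and g: "g \<in> F_vecs p n"
    and big: "7 * card S < 8 * card {x \<in> S. agree m g x}" and nc: "\<not> conc p n (Suc m) S"
  obtains s where "s \<in> F_vecs p n" "agree m g s"
    "card S \<le> 16 * p * card (first_diff p (Suc m) s {1} S)"
    "card S \<le> 16 * p * card (first_diff p (Suc m) s (- {0, 1}) S)"
proof -
  define C where "C = {x \<in> S. agree m g x}"
  define c where "c u = {x \<in> C. x (Suc m) = u}" for u
  have finS: "finite S" using S finite_subset by fastforce
  hence finC: "finite C" "\<And>u. finite (c u)" unfolding C_def c_def by auto
  have Sm: "Suc m \<in> {1..n}" using m by auto
  have rng: "0 \<le> x (Suc m) \<and> x (Suc m) < int p" if "x \<in> S" for x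
    using that S F_vecs_range[of x p n "Suc m"] Sm by blast
  have "\<exists>u\<in>{0..<int p}. card C \<le> p * card (c u)"
  proof (rule ccontr)
    assume "\<not> ?thesis"
    hence lt: "p * card (c u) < card C" if "u \<in> {0..<int p}" for u using that by (simp add: not_le)
    have "(\<lambda>x. x (Suc m)) ` C \<subseteq> {0..<int p}" using rng unfolding C_def by auto
    from sum.group[OF finC(1) _ this, of "\<lambda>_. 1::nat"]
    have "card C = (\<Sum>u\<in>{0..<int p}. card (c u))" unfolding c_def by simp
    hence "p * card C = (\<Sum>u\<in>{0..<int p}. p * card (c u))" by (simp add: sum_distrib_left)
    also have "\<dots> < (\<Sum>u\<in>{0..<int p}. card C)" using lt p by (intro sum_strict_mono) auto
    finally show False by simp
  qed
  then obtain u where u: "0 \<le> u" "u < int p" and cu: "card C \<le> p * card (c u)" by auto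
  have cS: "c u \<subseteq> S" unfolding c_def C_def by auto
  have "c u = {x \<in> S. agree (Suc m) (g(Suc m := u)) x}"
    unfolding c_def C_def agree_Suc by (auto simp: agree_def)
  \<comment> \<open>As \<open>S\<close> is not concentrated one level down, an eighth of it lies
    outside the child \<open>c u\<close>. This eighth will be shared by \<open>X2 1\<close> and
    \<open>X1 2\<close>.\<close>
  hence not_all: "8 * card (c u) \<le> 7 * card S"
    using nc F_vecs_upd[OF g Sm u] unfolding conc_def by (auto simp: not_less)
  \<comment> \<open>Relative to \<open>s k\<close> every vector of the child \<open>c u\<close> has
    difference \<open>k\<close> at the new coordinate: 1 decides for A(p,n), and 2 decides against
    it because \<open>p \<ge> 3\<close>.\<close>
  define s where "s k = g(Suc m := (u - k) mod int p)" for k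
  have sV: "s k \<in> F_vecs p n" for k unfolding s_def using p by (intro F_vecs_upd[OF g Sm]) auto
  have sag: "agree m g (s k)" for k unfolding s_def agree_def by auto
  have sval: "(y - s k (Suc m)) mod int p = (y - u + k) mod int p" for y k
    unfolding s_def by (simp add: mod_diff_right_eq algebra_simps)
  define X1 where "X1 k = first_diff p (Suc m) (s k) {1} S" for k
  define X2 where "X2 k = first_diff p (Suc m) (s k) (- {0, 1}) S" for k
  have finX: "finite (X1 k)" "finite (X2 k)" for k unfolding X1_def X2_def first_diff_def using finS by auto
  have in_C: "x \<in> first_diff p (Suc m) (s k) D S" if "x \<in> C" "(x (Suc m) - u + k) mod int p \<in> D" for x k D
  proof -
    have "agree (Suc m - 1) (s k) x"
      using that agree_trans[OF agree_sym[OF sag[of k]], of x] unfolding C_def by simp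
    moreover have "Suc m \<in> {1..Suc m}" "(x (Suc m) - s k (Suc m)) mod int p \<in> D" "x \<in> S"
      using that sval[of "x (Suc m)" k] unfolding C_def by auto
    ultimately show ?thesis unfolding first_diff_def by blast
  qed
  have "c u \<subseteq> X1 1" using p unfolding X1_def by (auto simp: c_def intro!: in_C)
  hence "card (c u) \<le> card (X1 1)" using finX by (intro card_mono)
  have "\<not> int p dvd 2" using p by (auto dest: zdvd_imp_le)
  hence "c u \<subseteq> X2 2" using p unfolding X2_def by (auto simp: c_def intro!: in_C)
  hence "card (c u) \<le> card (X2 2)" using finX by (intro card_mono)
  have "S - c u \<subseteq> X2 1 \<union> X1 2"
  proof
    fix x assume x: "x \<in> S - c u"
    show "x \<in> X2 1 \<union> X1 2"
    proof (cases "x \<in> C")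
      case True
      hence "x (Suc m) - u \<noteq> 0" using x unfolding c_def by auto
      moreover have "- int p < x (Suc m) - u" "x (Suc m) - u < int p" using rng[of x] x u by auto
      ultimately have "(x (Suc m) - u + 2) mod int p = 1 \<or> (x (Suc m) - u + 1) mod int p \<notin> {0, 1}"
        using p by (intro mod_shift_cases) auto
      thus ?thesis using in_C[OF True] unfolding X1_def X2_def by auto
    next
      case False
      hence "\<exists>i. i \<in> {1..m} \<and> x i \<noteq> g i" using x unfolding C_def agree_def by force
      then obtain i where i: "i \<in> {1..m}" "x i \<noteq> g i" and least: "\<And>j. j < i \<Longrightarrow> \<not> (j \<in> {1..m} \<and> x j \<noteq> g j)"
        using exists_least_iff[of "\<lambda>i. i \<in> {1..m} \<and> x i \<noteq> g i"] by auto
      \<comment> \<open>Outside \<open>C\<close> the first difference occurs among the first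
        \<open>m\<close> coordinates, where all \<open>s k\<close> coincide with \<open>g\<close>.
        So the side on which \<open>x\<close> falls does not depend on \<open>k\<close>.\<close>
      have sg: "s k j = g j" if "j \<le> m" for k j unfolding s_def using that by auto
      have ag: "agree (i - 1) (s k) x" for k
        unfolding agree_def
      proof
        fix j assume "j \<in> {1..i - 1}"
        hence "j < i" "j \<in> {1..m}" using i by auto
        thus "s k j = x j" using least[of j] sg[of j k] by auto
      qed
      have "x i mod int p \<noteq> g i mod int p"
        using i F_vecs_range[OF g, of i] F_vecs_range[of x p n i] x S m by auto
      hence "(x i - g i) mod int p \<noteq> 0" by (simp add: mod_eq_dvd_iff dvd_eq_mod_eq_0)
      hence D: "(x i - g i) mod int p \<in> {1} \<or> (x i - g i) mod int p \<in> - {0, 1}" by auto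
      have in_D: "x \<in> first_diff p (Suc m) (s k) D S" if "(x i - g i) mod int p \<in> D" for D k
      proof -
        have "i \<in> {1..Suc m}" "(x i - s k i) mod int p \<in> D" "x \<in> S" using that x i sg[of i k] by auto
        thus ?thesis unfolding first_diff_def using ag[of k] by blast
      qed
      show ?thesis using D in_D[of "{1}" 2] in_D[of "- {0, 1}" 1] unfolding X1_def X2_def by blast
    qed
  qed
  hence "card (S - c u) \<le> card (X2 1 \<union> X1 2)" using finX by (intro card_mono) auto
  also have "\<dots> \<le> card (X2 1) + card (X1 2)" by (rule card_Un_le)
  finally have "card S \<le> card (X2 1) + card (X1 2) + card (c u)"
    using card_Diff_subset[OF finC(2) cS] by simp
  hence sum: "card S \<le> 8 * card (X2 1) + 8 * card (X1 2)" using not_all by linarith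
  have le: "16 * k \<le> 16 * p * k" for k :: nat using p by simp
  have cbig: "card S \<le> 16 * p * card (c u)" using big cu unfolding C_def by linarith
  have "card S \<le> 16 * p * card (X1 1)" "card S \<le> 16 * p * card (X2 2)"
    using cbig mult_le_mono2[OF \<open>card (c u) \<le> card (X1 1)\<close>, of "16 * p"]
      mult_le_mono2[OF \<open>card (c u) \<le> card (X2 2)\<close>, of "16 * p"] by linarith+
  \<comment> \<open>In the first case the target \<open>s 1\<close> works, in the second
    \<open>s 2\<close>.\<close>
  moreover have "card S \<le> 16 * p * card (X2 1) \<or> card S \<le> 16 * p * card (X1 2)"
    using sum le[of "card (X2 1)"] le[of "card (X1 2)"] by linarith
  ultimately show ?thesis using that sV sag unfolding X1_def X2_def by blast
qed

section \<open>Sums decided by a prefix\<close>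

lemma first_diff_sum:
  assumes "zero_upto p m s g h" "agree m g y" "agree m h z"
    and "agree (i - 1) s x" "i \<in> {1..m}"
  shows "(x i + y i + z i) mod int p = (x i - s i) mod int p" "zero_upto p (i - 1) x y z"
proof -
  \<comment> \<open>On these coordinates \<open>y + z = g + h\<close>, which is congruent to
    \<open>- s\<close>; hence the sum is congruent to \<open>x - s\<close>.\<close>
  have eq: "(x j + y j + z j) mod int p = (x j - s j) mod int p" if "j \<in> {1..m}" for j
  proof -
    have "(x j + y j + z j) = (x j - s j) + (s j + g j + h j)"
      using assms(2,3) that unfolding agree_def by simp
    moreover have "(s j + g j + h j) mod int p = 0" using assms(1) that unfolding zero_upto_def by blast
    ultimately show ?thesis by (metis mod_add_right_eq add.right_neutral)
  qed
  show "(x i + y i + z i) mod int p = (x i - s i) mod int p" using eq assms(5) .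
  show "zero_upto p (i - 1) x y z"
    unfolding zero_upto_def
  proof
    fix j assume j: "j \<in> {1..i - 1}"
    hence "x j = s j" using assms(4) unfolding agree_def by auto
    thus "(x j + y j + z j) mod int p = 0" using eq[of j] j assms(5) by auto
  qed
qed

lemma first_diff_sum_in_A:
  assumes "zero_upto p m s g h" "agree m g y" "agree m h z" "m \<le> n"
    and "x \<in> first_diff p m s {1} S"
  shows "sum_in_A p n x y z"
proof -
  obtain i where i: "i \<in> {1..m}" "(x i - s i) mod int p = 1" "agree (i - 1) s x"
    using assms(5) unfolding first_diff_def by auto
  with first_diff_sum[OF assms(1-3) i(3,1)] show ?thesis
    unfolding sum_in_A_def using assms(4) by (auto intro!: bexI[of _ i])
qed

text \<open>The first nonzero coordinate of the sum is at \<open>i\<close> and is not 1. A witness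
  \<open>i'\<close> before \<open>i\<close> would meet a 0, and one after \<open>i\<close> would
  need a 0 at \<open>i\<close>.\<close>

lemma first_diff_not_sum_in_A:
  assumes "zero_upto p m s g h" "agree m g y" "agree m h z"
    and "x \<in> first_diff p m s (- {0, 1}) S"
  shows "\<not> sum_in_A p n x y z"
proof
  obtain i where i: "i \<in> {1..m}" "(x i - s i) mod int p \<notin> {0, 1}" "agree (i - 1) s x"
    using assms(4) unfolding first_diff_def by auto
  note s = first_diff_sum[OF assms(1-3) i(3,1)]
  assume "sum_in_A p n x y z"
  then obtain i' where i': "i' \<in> {1..n}" "(x i' + y i' + z i') mod int p = 1" "zero_upto p (i' - 1) x y z"
    unfolding sum_in_A_def by auto
  consider "i' < i" | "i' = i" | "i < i'" by linarith
  thus False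
  proof cases
    case 1
    hence "i' \<in> {1..i - 1}" using i' by auto
    thus ?thesis using s(2) i'(2) unfolding zero_upto_def by auto
  next
    case 2
    thus ?thesis using s(1) i'(2) i(2) by auto
  next
    case 3
    hence "i \<in> {1..i' - 1}" using i by auto
    thus ?thesis using s(1) i'(3) i(2) unfolding zero_upto_def by auto
  qed
qed

section \<open>Finding a split triple\<close>

text \<open>Choose \<open>g\<close> uniformly from the heavy vectors of the first kind whose part
  has broken up by level \<open>M\<close>, then \<open>(b, c)\<close> uniformly with
  \<open>b + c\<close> equal to minus the target of \<open>g\<close> on the first \<open>m g\<close>
  coordinates. A union bound finds a triple with \<open>b\<close> and \<open>c\<close> good and no
  pair in \<open>R\<close>. The factor 3072 is 48 times 64, from \<open>heavy\<close> and
  \<open>good\<close>.\<close>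

lemma exists_split_triple:
  fixes R :: "nat \<Rightarrow> nat \<Rightarrow> bool"
  assumes p: "p \<ge> 3" and M: "1 \<le> M" "M \<le> n"
    and A0: "15 * p ^ n \<le> 16 * card {g \<in> F_vecs p n. heavy p n v fA g}"
    and A: "8 * card (typical p n v fA M) < 7 * p ^ n"
    and B: "7 * p ^ n \<le> 8 * card (typical p n v fB (M - 1))"
    and C: "7 * p ^ n \<le> 8 * card (typical p n v fC (M - 1))"
    and RAB: "10000 * p * card {(g, h) \<in> F_vecs p n \<times> F_vecs p n. R (fA g) (fB h)} \<le> (p ^ n)\<^sup>2"
    and RAC: "10000 * p * card {(g, h) \<in> F_vecs p n \<times> F_vecs p n. R (fA g) (fC h)} \<le> (p ^ n)\<^sup>2"
    and RBC: "10000 * p * card {(g, h) \<in> F_vecs p n \<times> F_vecs p n. R (fB g) (fC h)} \<le> (p ^ n)\<^sup>2"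
  obtains a b c X X' Y Z where "a \<in> F_vecs p n" "b \<in> F_vecs p n" "c \<in> F_vecs p n"
    "\<not> R (fA a) (fB b)" "\<not> R (fA a) (fC c)" "\<not> R (fB b) (fC c)"
    "X \<subseteq> cls p n fA a" "X' \<subseteq> cls p n fA a" "Y \<subseteq> cls p n fB b" "Z \<subseteq> cls p n fC c"
    "v (fA a) \<le> 3072 * p * card X" "v (fA a) \<le> 3072 * p * card X'"
    "v (fB b) \<le> 3072 * p * card Y" "v (fC c) \<le> 3072 * p * card Z"
    "\<forall>x\<in>X. \<forall>y\<in>Y. \<forall>z\<in>Z. sum_in_A p n x y z"
    "\<forall>x\<in>X'. \<forall>y\<in>Y. \<forall>z\<in>Z. \<not> sum_in_A p n x y z"
proof -
  let ?V = "F_vecs p n"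
  define N :: real where "N = real (p ^ n)"
  have N: "N > 0" unfolding N_def using p by simp
  have cardV: "real (card ?V) = N" unfolding N_def card_F_vecs ..
  \<comment> \<open>At least 15/16 - 7/8 = 1/16 of all vectors are in \<open>Q\<close>.\<close>
  define Q where "Q = {g \<in> ?V. heavy p n v fA g \<and> \<not> conc p n M (cls p n fA g)}"
  have finQ: "finite Q" and QV: "Q \<subseteq> ?V" unfolding Q_def by auto
  have Qcard: "N \<le> 16 * real (card Q)"
  proof -
    have "{g \<in> ?V. heavy p n v fA g} = Q \<union> typical p n v fA M" unfolding Q_def typical_def by auto
    hence "card {g \<in> ?V. heavy p n v fA g} \<le> card Q + card (typical p n v fA M)"
      by (simp add: card_Un_le)
    hence "p ^ n \<le> 16 * card Q" using A0 A by linarith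
    hence "real (p ^ n) \<le> real (16 * card Q)" by (simp only: of_nat_le_iff)
    thus ?thesis unfolding N_def by simp
  qed
  \<comment> \<open>The depth of a class. The \<open>LEAST\<close> is meaningful for the classes of
    \<open>Q\<close>, which are not concentrated at level \<open>M\<close>.\<close>
  define dep where "dep S = (LEAST m. \<not> conc p n m S)" for S
  define isT where "isT S s \<longleftrightarrow> s \<in> ?V \<and> 7 * card S < 8 * card {x \<in> S. agree (dep S - 1) s x} \<and>
     card S \<le> 16 * p * card (first_diff p (dep S) s {1} S) \<and>
     card S \<le> 16 * p * card (first_diff p (dep S) s (- {0, 1}) S)" for S s
  have dep: "1 \<le> dep S" "dep S \<le> M" "\<exists>s. isT S s" if S: "S = cls p n fA g" "g \<in> Q" for S g
  proof -
    have nc: "\<not> conc p n M S" using S unfolding Q_def by simp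
    have gS: "g \<in> S" using S QV unfolding cls_def by auto
    have finS: "finite S" using S by simp
    hence "0 < card S" using gS by (auto simp: card_gt_0_iff)
    hence "conc p n 0 S" using S QV unfolding conc_def by auto
    moreover have nd: "\<not> conc p n (dep S) S" unfolding dep_def using nc by (rule LeastI)
    ultimately show d1: "1 \<le> dep S" by (cases "dep S") auto
    show dM: "dep S \<le> M" unfolding dep_def using nc by (rule Least_le)
    have "conc p n (dep S - 1) S"
      using not_less_Least[of "dep S - 1" "\<lambda>m. \<not> conc p n m S"] d1 unfolding dep_def[symmetric] by auto
    then obtain h where h: "h \<in> ?V" "7 * card S < 8 * card {x \<in> S. agree (dep S - 1) h x}"
      unfolding conc_def by auto
    obtain s where s: "s \<in> ?V" "agree (dep S - 1) h s"
      "card S \<le> 16 * p * card (first_diff p (Suc (dep S - 1)) s {1} S)"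
      "card S \<le> 16 * p * card (first_diff p (Suc (dep S - 1)) s (- {0, 1}) S)"
    proof (rule split_target[OF p _ _ _ h])
      show "S \<subseteq> ?V" using S cls_subset by simp
      show "S \<noteq> {}" using gS by auto
      show "dep S - 1 < n" using dM d1 M by linarith
      show "\<not> conc p n (Suc (dep S - 1)) S" using nd d1 by simp
    qed
    have "{x \<in> S. agree (dep S - 1) h x} \<subseteq> {x \<in> S. agree (dep S - 1) s x}"
      using agree_trans[OF agree_sym[OF s(2)]] by blast
    hence "card {x \<in> S. agree (dep S - 1) h x} \<le> card {x \<in> S. agree (dep S - 1) s x}"
      using finS by (intro card_mono) auto
    hence "isT S s" using h s d1 unfolding isT_def by auto
    thus "\<exists>s. isT S s" by blast
  qed
  \<comment> \<open>The target is chosen per class and not per vector, so that \<open>m\<close> and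
    \<open>s\<close> are constant on the class of a vector.\<close>
  define tgt where "tgt S = (SOME s. isT S s)" for S
  define m where "m g = dep (cls p n fA g)" for g
  define s where "s g = tgt (cls p n fA g)" for g
  have m: "1 \<le> m g" "m g \<le> M" "m g \<le> n" if "g \<in> Q" for g
    using dep(1,2)[OF refl that] M unfolding m_def by auto
  have "isT (cls p n fA g) (s g)" if "g \<in> Q" for g
    unfolding s_def tgt_def using dep(3)[OF refl that] by (rule someI_ex)
  hence s: "s g \<in> ?V" "7 * card (cls p n fA g) < 8 * card {x \<in> cls p n fA g. agree (m g - 1) (s g) x}"
    "card (cls p n fA g) \<le> 16 * p * card (first_diff p (m g) (s g) {1} (cls p n fA g))"
    "card (cls p n fA g) \<le> 16 * p * card (first_diff p (m g) (s g) (- {0, 1}) (cls p n fA g))"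
    if "g \<in> Q" for g using that unfolding isT_def m_def by auto
  have class_inv: "m h = m g" "s h = s g" "h \<in> Q \<longleftrightarrow> g \<in> Q" if "fA h = fA g" "h \<in> ?V" "g \<in> ?V" for g h
    unfolding m_def s_def Q_def using cls_cong[OF that(1), of p n] heavy_cong[OF that(1), of p n v] that by auto
  \<comment> \<open>The weight \<open>p ^ m g\<close> normalises: for fixed \<open>g\<close> and
    \<open>b\<close> the sum over \<open>c\<close> is \<open>N\<close>, and likewise with
    \<open>b\<close> and \<open>c\<close> exchanged. These are the uniform marginals of
    \<open>(g, b)\<close> and \<open>(g, c)\<close>.\<close>
  define q :: "(nat \<Rightarrow> int) \<Rightarrow> (nat \<Rightarrow> int) \<Rightarrow> (nat \<Rightarrow> int) \<Rightarrow> real" where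
    "q g b c = (if zero_upto p (m g) (s g) b c then real p ^ m g else 0)" for g b c
  have q0: "0 \<le> q g b c" for g b c unfolding q_def by simp
  have pw: "real p ^ m g * real (p ^ (n - m g)) = N" if "g \<in> Q" for g
    unfolding N_def using m(3)[OF that] by (simp flip: power_add)
  have qc: "(\<Sum>c\<in>?V. q g b c) = N" if "g \<in> Q" for g b
  proof -
    have "(\<Sum>c\<in>?V. q g b c) = (\<Sum>c\<in>{c \<in> ?V. zero_upto p (m g) (s g) b c}. real p ^ m g)"
      unfolding q_def by (rule sum.inter_filter[symmetric]) simp
    also have "\<dots> = real (p ^ (n - m g)) * real p ^ m g"
      using card_zero_upto[of p "m g" n "s g" b] m(3)[OF that] p by simp
    finally show ?thesis using pw[OF that] by (simp add: mult.commute)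
  qed
  have qb: "(\<Sum>b\<in>?V. q g b c) = N" if "g \<in> Q" for g c
    using qc[OF that, of c] unfolding q_def by (subst zero_upto_commute) 
  \<comment> \<open>Every class counted here has more than 7/8 of its vectors in the cell of
    \<open>s h\<close> at level \<open>m h - 1\<close>, hence in the cell of \<open>s g\<close> at
    level \<open>m g - 1\<close>. That cell has \<open>p * p ^ (n - m g)\<close> vectors, which
    limits the total.\<close>
  have nested: "8 * real p * N \<ge> 7 * (real p ^ m g * real (card {h \<in> Q. m g \<le> m h \<and> agree (m g) (s g) (s h)}))"
    if g: "g \<in> Q" for g
  proof -
    define Hs where "Hs = {h \<in> Q. m g \<le> m h \<and> agree (m g) (s g) (s h)}"
    have HsV: "Hs \<subseteq> ?V" "finite Hs" unfolding Hs_def using QV finQ by auto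
    have "7 * card Hs \<le> 8 * card {x \<in> Hs. agree (m g - 1) (s g) x}"
    proof (rule card_class_transfer[where f = fA])
      fix i assume "i \<in> fA ` Hs"
      then obtain h where h: "h \<in> Hs" "i = fA h" by blast
      hence hQ: "h \<in> Q" "m g \<le> m h" "agree (m g) (s g) (s h)" unfolding Hs_def by auto
      have in_Hs: "x \<in> Hs" if "x \<in> cls p n fA h" for x
        using that hQ QV class_inv[of x h] unfolding Hs_def cls_def by auto
      have eq: "{x \<in> Hs. fA x = i} = cls p n fA h"
        using in_Hs HsV unfolding h(2) cls_def by auto
      have ag: "agree (m g - 1) (s g) (s h)" using agree_mono[OF hQ(3)] by simp
      have "7 * card (cls p n fA h) < 8 * card {x \<in> cls p n fA h. agree (m h - 1) (s h) x}"
        using s(2)[OF hQ(1)] .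
      also have "card {x \<in> cls p n fA h. agree (m h - 1) (s h) x} \<le> card {x \<in> cls p n fA h. agree (m g - 1) (s g) x}"
      proof (rule card_mono)
        show "{x \<in> cls p n fA h. agree (m h - 1) (s h) x} \<subseteq> {x \<in> cls p n fA h. agree (m g - 1) (s g) x}"
        proof
          fix x assume "x \<in> {x \<in> cls p n fA h. agree (m h - 1) (s h) x}"
          hence x: "x \<in> cls p n fA h" "agree (m h - 1) (s h) x" by auto
          have "agree (m g - 1) (s h) x" using x(2) hQ(2) by (rule agree_mono[OF _ diff_le_mono])
          with ag have "agree (m g - 1) (s g) x" by (rule agree_trans)
          thus "x \<in> {x \<in> cls p n fA h. agree (m g - 1) (s g) x}" using x by simp
        qed
      qed simp
      finally have "7 * card (cls p n fA h) \<le> 8 * card {x \<in> cls p n fA h. agree (m g - 1) (s g) x}" by simp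
      moreover have "{x \<in> {x \<in> Hs. agree (m g - 1) (s g) x}. fA x = i} = {x \<in> cls p n fA h. agree (m g - 1) (s g) x}"
        unfolding eq[symmetric] by auto
      ultimately show "7 * card {x \<in> Hs. fA x = i} \<le> 8 * card {x \<in> {x \<in> Hs. agree (m g - 1) (s g) x}. fA x = i}"
        unfolding eq by simp
    qed (use HsV in auto)
    also have "card {x \<in> Hs. agree (m g - 1) (s g) x} \<le> card {x \<in> ?V. agree (m g - 1) (s g) x}"
      using HsV by (intro card_mono) auto
    also have "\<dots> = p ^ (n - (m g - 1))" using s(1)[OF g] m[OF g] by (intro card_agree) auto
    also have "n - (m g - 1) = Suc (n - m g)" using m[OF g] by linarith
    finally have "7 * card Hs \<le> 8 * (p * p ^ (n - m g))" by simp
    hence "real (7 * card Hs) \<le> real (8 * (p * p ^ (n - m g)))" by (simp only: of_nat_le_iff)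
    hence "real p ^ m g * (7 * real (card Hs)) \<le> real p ^ m g * (8 * (real p * real (p ^ (n - m g))))"
      by (intro mult_left_mono) auto
    thus ?thesis using pw[OF g] unfolding Hs_def by (simp add: mult_ac)
  qed
  \<comment> \<open>Up to scaling, \<open>w\<close> is the density of the random pair \<open>(b, c)\<close>.  It can be unbounded, since the
    depths \<open>m g\<close> are, but two cells contribute to the same pair only if they are nested.\<close>
  define w where "w b c = (\<Sum>g\<in>Q. q g b c)" for b c
  have w2: "(\<Sum>b\<in>?V. \<Sum>c\<in>?V. (w b c)\<^sup>2) \<le> 16/7 * real p * N ^ 4"
  proof -
    define P where "P g h = (\<Sum>b\<in>?V. \<Sum>c\<in>?V. q g b c * q h b c)" for g h
    \<comment> \<open>\<open>J g h\<close> bounds the correlation \<open>P g h\<close> if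
      \<open>m g \<le> m h\<close>: \<open>q g\<close> is at most \<open>p ^ m g\<close> and
      \<open>q h\<close> sums to the square of \<open>N\<close>, while for targets that are not
      nested the products vanish. For the other order \<open>J h g\<close> is used.\<close>
    define J where "J g h = (if m g \<le> m h \<and> agree (m g) (s g) (s h) then real p ^ m g * N\<^sup>2 else 0)" for g h
    have P1: "P g h \<le> J g h" if gh: "g \<in> Q" "h \<in> Q" "m g \<le> m h" for g h
    proof (cases "agree (m g) (s g) (s h)")
      case True
      have "P g h \<le> (\<Sum>b\<in>?V. \<Sum>c\<in>?V. real p ^ m g * q h b c)"
        unfolding P_def by (intro sum_mono mult_right_mono q0) (auto simp: q_def)
      also have "\<dots> = (\<Sum>b\<in>?V. real p ^ m g * N)"
        using qc[OF gh(2)] by (simp flip: sum_distrib_left)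
      also have "\<dots> = real p ^ m g * N\<^sup>2"
        using cardV by (simp add: power2_eq_square)
      finally show ?thesis using True gh unfolding J_def by simp
    next
      case False
      have zero: "q g b c * q h b c = 0" for b c
        using False zero_upto_agree[of p "m g" "s g" b c "m h" "s h" n] gh m s(1) unfolding q_def by auto
      show ?thesis unfolding P_def J_def zero using False by simp
    qed
    have J0: "0 \<le> J g h" for g h unfolding J_def by simp
    have P2: "P g h \<le> J g h + J h g" if "g \<in> Q" "h \<in> Q" for g h
    proof (cases "m g \<le> m h")
      case True
      thus ?thesis using P1[OF that] J0[of h g] by linarith
    next
      case False
      have "P g h = P h g" unfolding P_def by (simp add: mult.commute)
      thus ?thesis using P1[OF that(2,1)] False J0[of g h] by linarith
    qed
    have J1: "(\<Sum>h\<in>Q. J g h) \<le> 8/7 * real p * N ^ 3" if "g \<in> Q" for g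
    proof -
      have "(\<Sum>h\<in>Q. J g h) = (\<Sum>h\<in>{h \<in> Q. m g \<le> m h \<and> agree (m g) (s g) (s h)}. real p ^ m g * N\<^sup>2)"
        unfolding J_def using finQ by (rule sum.inter_filter[symmetric])
      also have "\<dots> = real p ^ m g * real (card {h \<in> Q. m g \<le> m h \<and> agree (m g) (s g) (s h)}) * N\<^sup>2"
        by simp
      also have "\<dots> \<le> (8/7 * real p * N) * N\<^sup>2"
        using nested[OF that] by (intro mult_right_mono) auto
      finally show ?thesis by (simp add: power2_eq_square power3_eq_cube mult_ac)
    qed
    have "(\<Sum>b\<in>?V. \<Sum>c\<in>?V. (w b c)\<^sup>2) = (\<Sum>b\<in>?V. \<Sum>c\<in>?V. \<Sum>g\<in>Q. \<Sum>h\<in>Q. q g b c * q h b c)"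
      unfolding w_def power2_eq_square sum_product ..
    also have "\<dots> = (\<Sum>b\<in>?V. \<Sum>g\<in>Q. \<Sum>c\<in>?V. \<Sum>h\<in>Q. q g b c * q h b c)"
      by (intro sum.cong refl sum.swap)
    also have "\<dots> = (\<Sum>g\<in>Q. \<Sum>b\<in>?V. \<Sum>c\<in>?V. \<Sum>h\<in>Q. q g b c * q h b c)"
      by (rule sum.swap)
    also have "\<dots> = (\<Sum>g\<in>Q. \<Sum>b\<in>?V. \<Sum>h\<in>Q. \<Sum>c\<in>?V. q g b c * q h b c)"
      by (intro sum.cong refl sum.swap)
    also have "\<dots> = (\<Sum>g\<in>Q. \<Sum>h\<in>Q. P g h)"
      unfolding P_def by (intro sum.cong refl sum.swap)
    also have "\<dots> \<le> (\<Sum>g\<in>Q. \<Sum>h\<in>Q. J g h + J h g)"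
      by (intro sum_mono P2)
    also have "\<dots> = 2 * (\<Sum>g\<in>Q. \<Sum>h\<in>Q. J g h)"
      using sum.swap[of "\<lambda>g h. J h g" Q Q] by (simp add: sum.distrib)
    also have "(\<Sum>g\<in>Q. \<Sum>h\<in>Q. J g h) \<le> (\<Sum>g\<in>Q. 8/7 * real p * N ^ 3)"
      by (intro sum_mono J1)
    also have "\<dots> = real (card Q) * (8/7 * real p * N ^ 3)" by simp
    also have "\<dots> \<le> N * (8/7 * real p * N ^ 3)"
      using card_mono[OF finite_F_vecs QV] N unfolding cardV[symmetric] by (intro mult_right_mono) auto
    finally show ?thesis by (simp add: power4_eq_xxxx power3_eq_cube mult_ac)
  qed
  define \<beta>B where "\<beta>B b = (of_bool (\<not> good p n v fB M b) :: real)" for b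
  define \<beta>C where "\<beta>C c = (of_bool (\<not> good p n v fC M c) :: real)" for c
  define \<rho>AB where "\<rho>AB g b = (of_bool (R (fA g) (fB b)) :: real)" for g b
  define \<rho>AC where "\<rho>AC g c = (of_bool (R (fA g) (fC c)) :: real)" for g c
  define \<rho>BC where "\<rho>BC b c = (of_bool (R (fB b) (fC c)) :: real)" for b c
  have pair_sum: "(\<Sum>g\<in>?V. \<Sum>h\<in>?V. (of_bool (S g h) :: real)) = real (card {(g, h) \<in> ?V \<times> ?V. S g h})" for S
  proof -
    have "(\<Sum>g\<in>?V. \<Sum>h\<in>?V. (of_bool (S g h) :: real)) = (\<Sum>x\<in>?V \<times> ?V. if S (fst x) (snd x) then 1 else 0)"
      by (simp add: sum.cartesian_product case_prod_beta of_bool_def)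
    also have "\<dots> = (\<Sum>x\<in>{x \<in> ?V \<times> ?V. S (fst x) (snd x)}. 1)"
      by (rule sum.inter_filter[symmetric]) simp
    also have "{x \<in> ?V \<times> ?V. S (fst x) (snd x)} = {(g, h) \<in> ?V \<times> ?V. S g h}" by auto
    finally show ?thesis by simp
  qed
  have badsum: "k * 10000 * real p \<le> N\<^sup>2" if "10000 * p * kk \<le> (p ^ n)\<^sup>2" "k = real kk" for k kk
  proof -
    have "real (10000 * p * kk) \<le> real ((p ^ n)\<^sup>2)" using that(1) by (simp only: of_nat_le_iff)
    thus ?thesis using that(2) unfolding N_def by (simp add: mult_ac)
  qed
  have RAB': "(\<Sum>g\<in>?V. \<Sum>b\<in>?V. \<rho>AB g b) * 10000 * real p \<le> N\<^sup>2"
    using badsum[OF RAB refl] unfolding \<rho>AB_def pair_sum by simp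
  have RAC': "(\<Sum>g\<in>?V. \<Sum>b\<in>?V. \<rho>AC g b) * 10000 * real p \<le> N\<^sup>2"
    using badsum[OF RAC refl] unfolding \<rho>AC_def pair_sum by simp
  have RBC': "(\<Sum>g\<in>?V. \<Sum>b\<in>?V. \<rho>BC g b) * 10000 * real p \<le> N\<^sup>2"
    using badsum[OF RBC refl] unfolding \<rho>BC_def pair_sum by simp
  have count: "(\<Sum>b\<in>?V. (of_bool (S b) :: real)) = real (card {b \<in> ?V. S b})" for S
    using sum.inter_filter[of ?V "\<lambda>_. 1::real" S] by (simp add: of_bool_def)
  have notgood: "4 * (\<Sum>b\<in>?V. (of_bool (\<not> good p n v f M b) :: real)) \<le> N"
    if "7 * p ^ n \<le> 8 * card (typical p n v f (M - 1))" for f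
  proof -
    have "real (4 * card {g \<in> ?V. \<not> good p n v f M g}) \<le> real (p ^ n)"
      using card_not_good[OF _ M that] p by (simp only: of_nat_le_iff)
    thus ?thesis unfolding count N_def by simp
  qed
  have "\<exists>g\<in>Q. \<exists>b\<in>?V. \<exists>c\<in>?V. zero_upto p (m g) (s g) b c \<and> good p n v fB M b \<and> good p n v fC M c \<and>
    \<not> R (fA g) (fB b) \<and> \<not> R (fA g) (fC c) \<and> \<not> R (fB b) (fC c)"
  proof (rule ccontr)
    assume none: "\<not> ?thesis"
    \<comment> \<open>The union bound: if no triple works, each positive weight is charged to at
      least one of the five failures.\<close>
    have pointwise: "q g b c \<le> \<beta>B b * q g b c + \<beta>C c * q g b c + \<rho>AB g b * q g b c + \<rho>AC g c * q g b c + \<rho>BC b c * q g b c"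
      if "g \<in> Q" "b \<in> ?V" "c \<in> ?V" for g b c
    proof (cases "zero_upto p (m g) (s g) b c")
      case True
      hence "\<not> good p n v fB M b \<or> \<not> good p n v fC M c \<or> R (fA g) (fB b) \<or> R (fA g) (fC c) \<or> R (fB b) (fC c)"
        using none that by blast
      thus ?thesis using q0[of g b c] unfolding \<beta>B_def \<beta>C_def \<rho>AB_def \<rho>AC_def \<rho>BC_def by auto
    qed (simp add: q_def)
    have S0: "(\<Sum>g\<in>Q. \<Sum>b\<in>?V. \<Sum>c\<in>?V. q g b c) = real (card Q) * N\<^sup>2"
      using qc cardV by (simp add: power2_eq_square)
    have S1: "(\<Sum>g\<in>Q. \<Sum>b\<in>?V. \<Sum>c\<in>?V. \<beta>B b * q g b c) \<le> real (card Q) * N\<^sup>2 / 4"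
    proof -
      have "(\<Sum>g\<in>Q. \<Sum>b\<in>?V. \<Sum>c\<in>?V. \<beta>B b * q g b c) = (\<Sum>g\<in>Q. (\<Sum>b\<in>?V. \<beta>B b) * N)"
        by (intro sum.cong refl) (simp add: qc flip: sum_distrib_left sum_distrib_right)
      also have "\<dots> \<le> (\<Sum>g\<in>Q. N / 4 * N)"
        using notgood[OF B] N unfolding \<beta>B_def by (intro sum_mono mult_right_mono) auto
      finally show ?thesis by (simp add: power2_eq_square)
    qed
    have S2: "(\<Sum>g\<in>Q. \<Sum>b\<in>?V. \<Sum>c\<in>?V. \<beta>C c * q g b c) \<le> real (card Q) * N\<^sup>2 / 4"
    proof -
      have "(\<Sum>g\<in>Q. \<Sum>b\<in>?V. \<Sum>c\<in>?V. \<beta>C c * q g b c) = (\<Sum>g\<in>Q. \<Sum>c\<in>?V. \<Sum>b\<in>?V. \<beta>C c * q g b c)"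
        by (intro sum.cong refl sum.swap)
      also have "\<dots> = (\<Sum>g\<in>Q. (\<Sum>b\<in>?V. \<beta>C b) * N)"
        by (intro sum.cong refl) (simp add: qb flip: sum_distrib_left sum_distrib_right)
      also have "\<dots> \<le> (\<Sum>g\<in>Q. N / 4 * N)"
        using notgood[OF C] N unfolding \<beta>C_def by (intro sum_mono mult_right_mono) auto
      finally show ?thesis by (simp add: power2_eq_square)
    qed
    have S3: "(\<Sum>g\<in>Q. \<Sum>b\<in>?V. \<Sum>c\<in>?V. \<rho>AB g b * q g b c) \<le> (\<Sum>g\<in>?V. \<Sum>b\<in>?V. \<rho>AB g b) * N"
    proof -
      have "(\<Sum>g\<in>Q. \<Sum>b\<in>?V. \<Sum>c\<in>?V. \<rho>AB g b * q g b c) = (\<Sum>g\<in>Q. (\<Sum>b\<in>?V. \<rho>AB g b) * N)"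
        by (intro sum.cong refl) (simp add: qc flip: sum_distrib_left sum_distrib_right)
      also have "\<dots> = (\<Sum>g\<in>Q. \<Sum>b\<in>?V. \<rho>AB g b) * N" by (simp add: sum_distrib_right)
      also have "\<dots> \<le> (\<Sum>g\<in>?V. \<Sum>b\<in>?V. \<rho>AB g b) * N"
        using QV N by (intro mult_right_mono sum_mono2) (auto simp: \<rho>AB_def intro: sum_nonneg)
      finally show ?thesis .
    qed
    have S4: "(\<Sum>g\<in>Q. \<Sum>b\<in>?V. \<Sum>c\<in>?V. \<rho>AC g c * q g b c) \<le> (\<Sum>g\<in>?V. \<Sum>b\<in>?V. \<rho>AC g b) * N"
    proof -
      have "(\<Sum>g\<in>Q. \<Sum>b\<in>?V. \<Sum>c\<in>?V. \<rho>AC g c * q g b c) = (\<Sum>g\<in>Q. \<Sum>c\<in>?V. \<Sum>b\<in>?V. \<rho>AC g c * q g b c)"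
        by (intro sum.cong refl sum.swap)
      also have "\<dots> = (\<Sum>g\<in>Q. (\<Sum>b\<in>?V. \<rho>AC g b) * N)"
        by (intro sum.cong refl) (simp add: qb flip: sum_distrib_left sum_distrib_right)
      also have "\<dots> = (\<Sum>g\<in>Q. \<Sum>b\<in>?V. \<rho>AC g b) * N" by (simp add: sum_distrib_right)
      also have "\<dots> \<le> (\<Sum>g\<in>?V. \<Sum>b\<in>?V. \<rho>AC g b) * N"
        using QV N by (intro mult_right_mono sum_mono2) (auto simp: \<rho>AC_def intro: sum_nonneg)
      finally show ?thesis .
    qed
    \<comment> \<open>The parameter in \<open>w \<le> w\<^sup>2 / (2 * K) + K / 2\<close>, which
      replaces Cauchy-Schwarz. With this value the two terms give 2/175 and 1/200 of
      \<open>N ^ 3\<close>; together with the 2/10000 from the other pairs this stays below the 1/32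
      that the size of \<open>Q\<close> guarantees.\<close>
    define K where "K = 100 * real p * N"
    have K: "K > 0" unfolding K_def using p N by simp
    have S5: "(\<Sum>g\<in>Q. \<Sum>b\<in>?V. \<Sum>c\<in>?V. \<rho>BC b c * q g b c)
      \<le> 16/7 * real p * N ^ 4 / (2 * K) + K / 2 * (\<Sum>b\<in>?V. \<Sum>c\<in>?V. \<rho>BC b c)"
    proof -
      have "(\<Sum>g\<in>Q. \<Sum>b\<in>?V. \<Sum>c\<in>?V. \<rho>BC b c * q g b c) = (\<Sum>b\<in>?V. \<Sum>g\<in>Q. \<Sum>c\<in>?V. \<rho>BC b c * q g b c)"
        by (rule sum.swap)
      also have "\<dots> = (\<Sum>b\<in>?V. \<Sum>c\<in>?V. \<Sum>g\<in>Q. \<rho>BC b c * q g b c)"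
        by (intro sum.cong refl sum.swap)
      also have "\<dots> = (\<Sum>b\<in>?V. \<Sum>c\<in>?V. \<rho>BC b c * w b c)"
        unfolding w_def by (simp add: sum_distrib_left)
      also have "\<dots> \<le> (\<Sum>b\<in>?V. \<Sum>c\<in>?V. (w b c)\<^sup>2 / (2 * K) + K / 2 * \<rho>BC b c)"
      proof (intro sum_mono)
        fix b c
        have "0 \<le> (w b c - K)\<^sup>2" by simp
        hence "2 * K * w b c \<le> (w b c)\<^sup>2 + K * K" by (simp add: power2_eq_square algebra_simps)
        hence "w b c \<le> (w b c)\<^sup>2 / (2 * K) + K / 2" using K by (simp add: field_simps)
        thus "\<rho>BC b c * w b c \<le> (w b c)\<^sup>2 / (2 * K) + K / 2 * \<rho>BC b c"
          using K unfolding \<rho>BC_def by (cases "R (fB b) (fC c)") auto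
      qed
      also have "\<dots> = (\<Sum>b\<in>?V. \<Sum>c\<in>?V. (w b c)\<^sup>2) / (2 * K) + K / 2 * (\<Sum>b\<in>?V. \<Sum>c\<in>?V. \<rho>BC b c)"
        by (simp add: sum.distrib sum_distrib_left sum_divide_distrib)
      also have "\<dots> \<le> 16/7 * real p * N ^ 4 / (2 * K) + K / 2 * (\<Sum>b\<in>?V. \<Sum>c\<in>?V. \<rho>BC b c)"
        using w2 K by (intro add_right_mono divide_right_mono) auto
      finally show ?thesis .
    qed
    have "real (card Q) * N\<^sup>2 \<le> (\<Sum>g\<in>Q. \<Sum>b\<in>?V. \<Sum>c\<in>?V.
      \<beta>B b * q g b c + \<beta>C c * q g b c + \<rho>AB g b * q g b c + \<rho>AC g c * q g b c + \<rho>BC b c * q g b c)"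
      unfolding S0[symmetric] by (intro sum_mono pointwise)
    also have "\<dots> = (\<Sum>g\<in>Q. \<Sum>b\<in>?V. \<Sum>c\<in>?V. \<beta>B b * q g b c) + (\<Sum>g\<in>Q. \<Sum>b\<in>?V. \<Sum>c\<in>?V. \<beta>C c * q g b c)
      + (\<Sum>g\<in>Q. \<Sum>b\<in>?V. \<Sum>c\<in>?V. \<rho>AB g b * q g b c) + (\<Sum>g\<in>Q. \<Sum>b\<in>?V. \<Sum>c\<in>?V. \<rho>AC g c * q g b c)
      + (\<Sum>g\<in>Q. \<Sum>b\<in>?V. \<Sum>c\<in>?V. \<rho>BC b c * q g b c)"
      by (simp add: sum.distrib)
    finally have main: "real (card Q) * N\<^sup>2 / 2 \<le> (\<Sum>g\<in>?V. \<Sum>b\<in>?V. \<rho>AB g b) * N + (\<Sum>g\<in>?V. \<Sum>b\<in>?V. \<rho>AC g b) * N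
      + (16/7 * real p * N ^ 4 / (2 * K) + K / 2 * (\<Sum>b\<in>?V. \<Sum>c\<in>?V. \<rho>BC b c))"
      using S1 S2 S3 S4 S5 by linarith
    have p1: "1 \<le> real p" using p by simp
    have drop_p: "x * 10000 \<le> N\<^sup>2" if "x * 10000 * real p \<le> N\<^sup>2" "0 \<le> x" for x
      using mult_left_mono[OF p1, of "x * 10000"] that by linarith
    have T3: "(\<Sum>g\<in>?V. \<Sum>b\<in>?V. \<rho>AB g b) * N \<le> N ^ 3 / 10000"
      using mult_right_mono[OF drop_p[OF RAB'], of N] N
      by (simp add: power2_eq_square power3_eq_cube sum_nonneg \<rho>AB_def)
    have T4: "(\<Sum>g\<in>?V. \<Sum>b\<in>?V. \<rho>AC g b) * N \<le> N ^ 3 / 10000"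
      using mult_right_mono[OF drop_p[OF RAC'], of N] N
      by (simp add: power2_eq_square power3_eq_cube sum_nonneg \<rho>AC_def)
    have T5: "K / 2 * (\<Sum>b\<in>?V. \<Sum>c\<in>?V. \<rho>BC b c) \<le> N ^ 3 / 200"
      using mult_right_mono[OF RBC', of N] N unfolding K_def
      by (simp add: power2_eq_square power3_eq_cube mult_ac)
    have T6: "16/7 * real p * N ^ 4 / (2 * K) = 2 / 175 * N ^ 3"
      unfolding K_def using N p by (simp add: field_simps power4_eq_xxxx power3_eq_cube)
    have "N ^ 3 / 32 \<le> real (card Q) * N\<^sup>2 / 2"
      using mult_right_mono[OF Qcard, of "N\<^sup>2"] by (simp add: power2_eq_square power3_eq_cube)
    moreover have "0 < N ^ 3" using N by simp
    ultimately show False using main T3 T4 T5 T6 by linarith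
  qed
  then obtain g b c where gbc: "g \<in> Q" "b \<in> ?V" "c \<in> ?V" and z: "zero_upto p (m g) (s g) b c"
    and good: "good p n v fB M b" "good p n v fC M c"
    and nR: "\<not> R (fA g) (fB b)" "\<not> R (fA g) (fC c)" "\<not> R (fB b) (fC c)" by blast
  let ?A = "cls p n fA g"
  let ?Y = "{x \<in> cls p n fB b. agree M b x}"
  let ?Z = "{x \<in> cls p n fC c. agree M c x}"
  have comb: "x \<le> 3072 * p * y" if "x \<le> 48 * k" "k \<le> j * p * y" "j \<le> 64" for x k y j :: nat
  proof -
    have "k \<le> j * (p * y)" using that(2) by (simp only: mult.assoc)
    also have "\<dots> \<le> 64 * (p * y)" using that(3) by (rule mult_le_mono1)
    finally have "k \<le> 64 * (p * y)" .
    hence "48 * k \<le> 3072 * (p * y)" by linarith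
    thus ?thesis using that(1) by (simp only: mult.assoc)
  qed
  have hA: "v (fA g) \<le> 48 * card ?A" using gbc(1) unfolding Q_def heavy_def by simp
  \<comment> \<open>Since \<open>m g \<le> M\<close>, all of \<open>?Y\<close> and \<open>?Z\<close>
    share the prefixes of \<open>b\<close> and \<open>c\<close> on which the target condition was
    imposed.\<close>
  have agM: "agree (m g) x y" if "agree M x y" for x y using agree_mono[OF that m(2)[OF gbc(1)]] .
  show ?thesis
  proof (rule that[of g b c "first_diff p (m g) (s g) {1} ?A" "first_diff p (m g) (s g) (- {0, 1}) ?A" ?Y ?Z])
    show "g \<in> ?V" using gbc QV by auto
    show "v (fA g) \<le> 3072 * p * card (first_diff p (m g) (s g) {1} ?A)"
      using comb[OF hA s(3)[OF gbc(1)]] by simp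
    show "v (fA g) \<le> 3072 * p * card (first_diff p (m g) (s g) (- {0, 1}) ?A)"
      using comb[OF hA s(4)[OF gbc(1)]] by simp
    show "v (fB b) \<le> 3072 * p * card ?Y" using good(1) comb[of _ _ 64] unfolding good_def heavy_def by blast
    show "v (fC c) \<le> 3072 * p * card ?Z" using good(2) comb[of _ _ 64] unfolding good_def heavy_def by blast
    show "\<forall>x\<in>first_diff p (m g) (s g) {1} ?A. \<forall>y\<in>?Y. \<forall>z\<in>?Z. sum_in_A p n x y z"
      using first_diff_sum_in_A[OF z _ _ m(3)[OF gbc(1)]] agM by blast
    show "\<forall>x\<in>first_diff p (m g) (s g) (- {0, 1}) ?A. \<forall>y\<in>?Y. \<forall>z\<in>?Z. \<not> sum_in_A p n x y z"
      using first_diff_not_sum_in_A[OF z] agM by blast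
  qed (use gbc nR in \<open>auto simp: first_diff_def\<close>)
qed

section \<open>Embeddings of \<open>GS\<^sub>p(n)\<close>\<close>

lemma vec_add_in_GS_A:
  assumes "p \<ge> 3"
  shows "vec_add p n (vec_add p n x y) z \<in> GS_A p n \<longleftrightarrow> sum_in_A p n x y z"
proof -
  have val: "vec_add p n (vec_add p n x y) z i = (x i + y i + z i) mod int p" if "i \<in> {1..n}" for i
    using that unfolding vec_add_def residue_ring_def by (simp add: mod_add_left_eq)
  have ext: "vec_add p n (vec_add p n x y) z \<in> extensional {1..n}"
    unfolding vec_add_def by simp
  have mem: "vec_add p n (vec_add p n x y) z \<in> F_vecs p n"
    using assms val ext unfolding F_vecs_eq PiE_iff by simp
  have one: "\<one>\<^bsub>F_p p\<^esub> = 1" "\<zero>\<^bsub>F_p p\<^esub> = 0" unfolding residue_ring_def by simp_all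
  have "vec_add p n (vec_add p n x y) z \<in> GS_A p n \<longleftrightarrow>
    (\<exists>i\<in>{1..n}. vec_add p n (vec_add p n x y) z i = 1 \<and>
      (\<forall>j. 1 \<le> j \<and> j < i \<longrightarrow> vec_add p n (vec_add p n x y) z j = 0))"
    unfolding GS_A_def one using mem by simp
  also have "\<dots> \<longleftrightarrow> sum_in_A p n x y z"
    unfolding sum_in_A_def zero_upto_def
  proof (intro bex_cong refl conj_cong)
    fix i assume i: "i \<in> {1..n}"
    show "vec_add p n (vec_add p n x y) z i = 1 \<longleftrightarrow> (x i + y i + z i) mod int p = 1"
      using val[OF i] by simp
    have *: "1 \<le> j \<and> j < i \<longleftrightarrow> j \<in> {1..i - 1}" for j by auto
    show "(\<forall>j. 1 \<le> j \<and> j < i \<longrightarrow> vec_add p n (vec_add p n x y) z j = 0) \<longleftrightarrow>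
      (\<forall>j\<in>{1..i - 1}. (x j + y j + z j) mod int p = 0)"
    proof -
      have v: "vec_add p n (vec_add p n x y) z j = (x j + y j + z j) mod int p" if "j \<in> {1..i - 1}" for j
        using val[of j] that i by auto
      show ?thesis unfolding * using v by metis
    qed
  qed
  finally show ?thesis .
qed

lemma sum_in_A_swap:
  "sum_in_A p n x y z \<longleftrightarrow> sum_in_A p n y x z"
  "sum_in_A p n x y z \<longleftrightarrow> sum_in_A p n x z y"
  by (simp_all add: sum_in_A_def zero_upto_def add_ac)

section \<open>Recovering the three parts from a copy inside a Trip\<close>

lemma rainbow_cases:
  fixes a b c :: nat
  assumes "{a, b, c} = {1, 2, 3}"
  shows "a = 1 \<and> b = 2 \<and> c = 3 \<or> a = 1 \<and> b = 3 \<and> c = 2 \<or> a = 2 \<and> b = 1 \<and> c = 3 \<or>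
    a = 2 \<and> b = 3 \<and> c = 1 \<or> a = 3 \<and> b = 1 \<and> c = 2 \<or> a = 3 \<and> b = 2 \<and> c = 1"
proof -
  have mem: "1 \<in> {a, b, c}" "2 \<in> {a, b, c}" "3 \<in> {a, b, c}" using assms by simp_all
  have "a \<in> {1, 2, 3}" "b \<in> {1, 2, 3}" "c \<in> {1, 2, 3}" using assms by blast+
  thus ?thesis by (elim insertE emptyE) (use mem in simp_all)
qed

text \<open>The edges of \<open>H\<close> are unordered, so the edge set of \<open>Trip H\<close> is
  invariant under permuting the three labels.\<close>

lemma rainbow_edge_in_Trip:
  assumes "{i, j, k} = {1, 2, 3}" "{u, v, w} \<in> hedges H"
  shows "{(i, u), (j, v), (k, w)} \<in> hedges (Trip H)"
proof -
  have base: "{(1, x), (2, y), (3, z)} \<in> hedges (Trip H)" if "{x, y, z} \<in> hedges H" for x y z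
    unfolding Trip_def using that by auto
  have "{u, w, v} \<in> hedges H" "{v, u, w} \<in> hedges H" "{v, w, u} \<in> hedges H"
    "{w, u, v} \<in> hedges H" "{w, v, u} \<in> hedges H"
    using assms(2) by (simp_all add: insert_commute)
  note edges = base[OF assms(2)] this[THEN base]
  from rainbow_cases[OF assms(1)] show ?thesis
    by (elim disjE conjE) (use edges in \<open>simp_all add: insert_commute\<close>)
qed

text \<open>Two edges sharing two vertices of a rainbow hypergraph have equally coloured third
  vertices. If \<open>u\<close> and \<open>v\<close> have the same first coordinate, or that of
  \<open>v\<close> is smaller by one, a common pair \<open>(e, w)\<close> exists: the sum with
  \<open>u\<close> is 1 at coordinate 1, and the sum with \<open>v\<close> is 1 there or is 0
  followed by 1. This uses \<open>n \<ge> 2\<close>; induction on the first coordinate then connects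
  every vector to \<open>e\<close>.\<close>

lemma third_colour_const:
  fixes c1 c2 c3 :: "(nat \<Rightarrow> int) \<Rightarrow> nat"
  assumes p: "p \<ge> 3" and n: "n \<ge> 2"
    and col: "\<And>x y z. x \<in> F_vecs p n \<Longrightarrow> y \<in> F_vecs p n \<Longrightarrow> z \<in> F_vecs p n \<Longrightarrow> sum_in_A p n x y z \<Longrightarrow>
      {c1 x, c2 y, c3 z} = {1, 2, 3}"
  obtains k where "\<And>u. u \<in> F_vecs p n \<Longrightarrow> c3 u = k"
proof -
  define e :: "nat \<Rightarrow> int" where "e = (\<lambda>i\<in>{1..n}. 0)"
  have e: "e \<in> F_vecs p n" unfolding e_def F_vecs_eq using p by auto
  have step: "c3 u = c3 v" if u: "u \<in> F_vecs p n" and v: "v \<in> F_vecs p n" and uv: "v 1 = u 1 \<or> v 1 = u 1 - 1" for u v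
  proof -
    define w where "w = (\<lambda>i\<in>{1..n}. if i = 1 then (1 - u 1) mod int p else if i = 2 then (1 - v 2) mod int p else 0)"
    have w: "w \<in> F_vecs p n" unfolding w_def F_vecs_eq using p by auto
    have e1: "e 1 = 0" "e 2 = 0" unfolding e_def using n by auto
    have w1: "w 1 = (1 - u 1) mod int p" "w 2 = (1 - v 2) mod int p" unfolding w_def using n by auto
    have s1: "(e 1 + w 1 + y) mod int p = (1 - u 1 + y) mod int p" for y
      unfolding e1 w1 by (simp add: mod_add_left_eq)
    have s2: "(e 2 + w 2 + v 2) mod int p = 1"
      unfolding e1 w1 using p by (simp add: mod_add_left_eq)
    have first: "sum_in_A p n e w y" if "y 1 = u 1" for y
    proof -
      have "(e 1 + w 1 + y 1) mod int p = 1" unfolding s1 that using p by simp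
      moreover have "zero_upto p (1 - 1) e w y" by (simp add: zero_upto_def)
      moreover have "1 \<in> {1..n}" using n by simp
      ultimately show ?thesis unfolding sum_in_A_def by blast
    qed
    have "sum_in_A p n e w v"
    proof (cases "v 1 = u 1")
      case False
      hence "(e 1 + w 1 + v 1) mod int p = 0" using uv unfolding s1 by auto
      hence "zero_upto p (2 - 1) e w v" unfolding zero_upto_def by auto
      moreover have "2 \<in> {1..n}" using n by simp
      ultimately show ?thesis unfolding sum_in_A_def using s2 by blast
    qed (rule first)
    moreover have "sum_in_A p n e w u" by (rule first) simp
    ultimately show ?thesis using rainbow_cases[OF col[OF e w u]] rainbow_cases[OF col[OF e w v]] by auto
  qed
  have all: "\<forall>u\<in>F_vecs p n. u 1 = int k \<longrightarrow> c3 u = c3 e" for k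
  proof (induction k)
    case 0
    have "e 1 = 0" unfolding e_def using n by simp
    thus ?case using step[OF _ e] by simp
  next
    case (Suc k)
    show ?case
    proof (intro ballI impI)
      fix u assume u: "u \<in> F_vecs p n" "u 1 = int (Suc k)"
      have m: "1 \<in> {1..n}" using n by simp
      have v: "u(1 := int k) \<in> F_vecs p n"
        using F_vecs_range[OF u(1) m] u(2) by (intro F_vecs_upd[OF u(1) m]) auto
      have "c3 u = c3 (u(1 := int k))" using u by (intro step[OF u(1) v]) auto
      also have "\<dots> = c3 e" using Suc v by auto
      finally show "c3 u = c3 e" .
    qed
  qed
  have "c3 u = c3 e" if "u \<in> F_vecs p n" for u
  proof -
    have "u 1 = int (nat (u 1))" using F_vecs_range[OF that, of 1] n by simp
    thus ?thesis using all that by blast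
  qed
  thus ?thesis using that by blast
qed

text \<open>Only crossing triples are prescribed. Disjointness of the three images follows later
  from edges having three elements.\<close>

definition GS_embedding ::
  "nat \<Rightarrow> nat \<Rightarrow> 'a set set \<Rightarrow> ((nat \<Rightarrow> int) \<Rightarrow> 'a) \<Rightarrow> ((nat \<Rightarrow> int) \<Rightarrow> 'a) \<Rightarrow> ((nat \<Rightarrow> int) \<Rightarrow> 'a) \<Rightarrow> bool" where
  "GS_embedding p n F a b c \<longleftrightarrow>
     inj_on a (F_vecs p n) \<and> inj_on b (F_vecs p n) \<and> inj_on c (F_vecs p n) \<and>
     (\<forall>x\<in>F_vecs p n. \<forall>y\<in>F_vecs p n. \<forall>z\<in>F_vecs p n. {a x, b y, c z} \<in> F \<longleftrightarrow> sum_in_A p n x y z)"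

lemma GS_embedding_swap12: "GS_embedding p n F a b c \<Longrightarrow> GS_embedding p n F b a c"
  unfolding GS_embedding_def using sum_in_A_swap(1)[of p n] by (simp add: insert_commute)

lemma GS_embedding_swap23: "GS_embedding p n F a b c \<Longrightarrow> GS_embedding p n F a c b"
  unfolding GS_embedding_def using sum_in_A_swap(2)[of p n] by (simp add: insert_commute)

lemma exists_sum_in_A:
  assumes "p \<ge> 3" "n \<ge> 1" "x \<in> F_vecs p n" "y \<in> F_vecs p n"
  obtains z where "z \<in> F_vecs p n" "sum_in_A p n x y z"
proof -
  define z where "z = (\<lambda>i\<in>{1..n}. (1 - x i - y i) mod int p)"
  have z: "z \<in> F_vecs p n" unfolding z_def F_vecs_eq using assms(1) by auto
  have "(x 1 + y 1 + z 1) mod int p = (x 1 + y 1 + (1 - x 1 - y 1)) mod int p"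
    unfolding z_def using assms(2) by (simp add: mod_add_right_eq)
  also have "\<dots> = 1" using assms(1) by simp
  finally have "(x 1 + y 1 + z 1) mod int p = 1" .
  moreover have "zero_upto p (1 - 1) x y z" by (simp add: zero_upto_def)
  moreover have "1 \<in> {1..n}" using assms(2) by simp
  ultimately have "sum_in_A p n x y z" unfolding sum_in_A_def by blast
  with z that show ?thesis by blast
qed

text \<open>A common point \<open>a x = b y\<close> could be completed by some \<open>c z\<close> to
  an edge with at most two elements.\<close>

lemma GS_embedding_disjoint:
  assumes "p \<ge> 3" "n \<ge> 1" "GS_embedding p n F a b c" and card3: "\<And>e. e \<in> F \<Longrightarrow> card e = 3"
  shows "a ` F_vecs p n \<inter> b ` F_vecs p n = {}"
proof (rule ccontr)
  assume "\<not> ?thesis"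
  then obtain x y where xy: "x \<in> F_vecs p n" "y \<in> F_vecs p n" "a x = b y" by auto
  obtain z where z: "z \<in> F_vecs p n" "sum_in_A p n x y z" using exists_sum_in_A[OF assms(1,2) xy(1,2)] .
  hence "{a x, b y, c z} \<in> F" using assms(3) xy unfolding GS_embedding_def by blast
  hence "card {a x, b y, c z} = 3" by (rule card3)
  moreover have "{a x, b y, c z} = {b y, c z}" using xy by auto
  moreover have "card {b y, c z} \<le> 2" by (cases "b y = c z") auto
  ultimately show False by simp
qed

text \<open>
  The isomorphism in \<^const>\<open>in_Trip\<close> need not respect the three parts, but every edge of a
  \<^const>\<open>Trip\<close> is rainbow, and the 3-partition of \<open>GS\<^sub>p(n)\<close> is unique for \<open>n \<ge> 2\<close>.
\<close>

lemma in_Trip_GS_embedding: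
  assumes p: "p \<ge> 3" and n: "n \<ge> 2" and "in_Trip (GS p n) \<H>"
  obtains H a b c where "H \<in> \<H>" "GS_embedding p n (hedges H) a b c"
    "a ` F_vecs p n \<union> b ` F_vecs p n \<union> c ` F_vecs p n \<subseteq> hverts H"
proof -
  let ?V = "F_vecs p n"
  obtain H U where H: "H \<in> \<H>" and U: "U \<subseteq> hverts (Trip H)" and iso: "hgraph_iso (GS p n) (induced_sub (Trip H) U)"
    using assms(3) unfolding in_Trip_def by blast
  obtain f where bij: "bij_betw f ({1,2,3} \<times> ?V) U"
    and edges: "{e \<in> hedges (Trip H). e \<subseteq> U} = (\<lambda>e. f ` e) ` hedges (GS p n)"
    using iso unfolding hgraph_iso_def induced_sub_def GS_def by auto
  have GS_edge: "{(1, x), (2, y), (3, z)} \<in> hedges (GS p n) \<longleftrightarrow> sum_in_A p n x y z"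
    if "x \<in> ?V" "y \<in> ?V" "z \<in> ?V" for x y z
  proof -
    have inj: "{(1::nat, x), (2, y), (3, z)} = {(1, x'), (2, y'), (3, z')} \<longleftrightarrow> x = x' \<and> y = y' \<and> z = z'" for x' y' z'
    proof
      assume eq: "{(1::nat, x), (2, y), (3, z)} = {(1, x'), (2, y'), (3, z')}"
      have "(1, x) \<in> {(1::nat, x'), (2, y'), (3, z')}" "(2, y) \<in> {(1::nat, x'), (2, y'), (3, z')}"
        "(3, z) \<in> {(1::nat, x'), (2, y'), (3, z')}" unfolding eq[symmetric] by simp_all
      thus "x = x' \<and> y = y' \<and> z = z'" by simp
    qed simp
    show ?thesis unfolding GS_def snd_conv vec_add_in_GS_A[OF p] using that inj by auto
  qed
  have GS_form: "\<exists>x\<in>?V. \<exists>y\<in>?V. \<exists>z\<in>?V. e = {(1, x), (2, y), (3, z)}" if "e \<in> hedges (GS p n)" for e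
    using that unfolding GS_def by auto
  have Trip_edge: "fst ` e = {1, 2, 3}" "snd ` e \<in> hedges H" if "e \<in> hedges (Trip H)" for e
    using that unfolding Trip_def by auto
  have image_edge: "f ` {(1, x), (2, y), (3, z)} \<in> hedges (Trip H)"
    if "x \<in> ?V" "y \<in> ?V" "z \<in> ?V" "sum_in_A p n x y z" for x y z
    using edges GS_edge[OF that(1-3)] that(4) by blast
  have col: "{fst (f (1, x)), fst (f (2, y)), fst (f (3, z))} = {1, 2, 3}"
    if "x \<in> ?V" "y \<in> ?V" "z \<in> ?V" "sum_in_A p n x y z" for x y z
    using Trip_edge(1)[OF image_edge[OF that]] by simp
  obtain k3 where k3: "\<And>u. u \<in> ?V \<Longrightarrow> fst (f (3, u)) = k3"
    using third_colour_const[OF p n, of "\<lambda>x. fst (f (1, x))" "\<lambda>x. fst (f (2, x))" "\<lambda>x. fst (f (3, x))"] col by blast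
  obtain k2 where k2: "\<And>u. u \<in> ?V \<Longrightarrow> fst (f (2, u)) = k2"
  proof (rule third_colour_const[OF p n, of "\<lambda>x. fst (f (1, x))" "\<lambda>x. fst (f (3, x))" "\<lambda>x. fst (f (2, x))"])
    fix x y z assume "x \<in> ?V" "y \<in> ?V" "z \<in> ?V" "sum_in_A p n x y z"
    thus "{fst (f (1, x)), fst (f (3, y)), fst (f (2, z))} = {1, 2, 3}"
      using col[of x z y] sum_in_A_swap[of p n] by (simp add: insert_commute)
  qed blast
  obtain k1 where k1: "\<And>u. u \<in> ?V \<Longrightarrow> fst (f (1, u)) = k1"
  proof (rule third_colour_const[OF p n, of "\<lambda>x. fst (f (2, x))" "\<lambda>x. fst (f (3, x))" "\<lambda>x. fst (f (1, x))"])
    fix x y z assume V: "x \<in> ?V" "y \<in> ?V" "z \<in> ?V" and "sum_in_A p n x y z"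
    hence "sum_in_A p n z x y" using sum_in_A_swap by blast
    thus "{fst (f (2, x)), fst (f (3, y)), fst (f (1, z))} = {1, 2, 3}"
      using col[OF V(3,1,2)] by (simp add: insert_commute)
  qed blast
  obtain v where v: "v \<in> ?V" using card_F_vecs[of p n] p by fastforce
  \<comment> \<open>A single edge shows that the three constant labels are a permutation of 1, 2,
    3.\<close>
  have k: "{k1, k2, k3} = {1, 2, 3}"
    using exists_sum_in_A[OF p _ v v] n col[OF v v] k1 k2 k3 v by (metis one_le_numeral order_trans)
  define a where "a x = snd (f (1, x))" for x
  define b where "b x = snd (f (2, x))" for x
  define c where "c x = snd (f (3, x))" for x
  have f_eq: "f (1, x) = (k1, a x)" "f (2, x) = (k2, b x)" "f (3, x) = (k3, c x)" if "x \<in> ?V" for x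
    using k1[OF that] k2[OF that] k3[OF that] unfolding a_def b_def c_def by (metis prod.collapse)+
  have finj: "inj_on f ({1,2,3} \<times> ?V)" using bij by (rule bij_betw_imp_inj_on)
  have inj: "inj_on a ?V" "inj_on b ?V" "inj_on c ?V"
    using f_eq inj_onD[OF finj] by (auto intro!: inj_onI) (metis SigmaI insertI1 insertI2 prod.inject)+
  have fU: "f x \<in> U" if "x \<in> {1,2,3} \<times> ?V" for x using bij that by (auto simp: bij_betw_def)
  have sub: "a x \<in> hverts H" "b x \<in> hverts H" "c x \<in> hverts H" if "x \<in> ?V" for x
    using fU[of "(1, x)"] fU[of "(2, x)"] fU[of "(3, x)"] U that f_eq[OF that] unfolding Trip_def by auto
  have edge: "{a x, b y, c z} \<in> hedges H \<longleftrightarrow> sum_in_A p n x y z" if V: "x \<in> ?V" "y \<in> ?V" "z \<in> ?V" for x y z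
  proof
    assume "sum_in_A p n x y z"
    from Trip_edge(2)[OF image_edge[OF V this]] show "{a x, b y, c z} \<in> hedges H"
      using f_eq V by simp
  next
    assume E: "{a x, b y, c z} \<in> hedges H"
    \<comment> \<open>An edge of \<open>H\<close> on these vertices, labelled by
      \<open>k1, k2, k3\<close>, is an edge of \<open>Trip H\<close> inside \<open>U\<close>, hence
      the image of an edge of \<open>GS p n\<close>. Injectivity of \<open>f\<close> identifies the
      latter with \<open>?e\<close>.\<close>
    let ?e = "{(1, x), (2, y), (3, z)}"
    have im: "f ` ?e = {(k1, a x), (k2, b y), (k3, c z)}" using f_eq V by simp
    have "f ` ?e \<in> hedges (Trip H)" unfolding im using k E by (rule rainbow_edge_in_Trip)
    moreover have eV: "?e \<subseteq> {1,2,3} \<times> ?V" using V by auto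
    moreover have "f ` ?e \<subseteq> U" using eV fU by blast
    ultimately have "f ` ?e \<in> (\<lambda>e. f ` e) ` hedges (GS p n)" using edges by blast
    then obtain e' where e': "e' \<in> hedges (GS p n)" "f ` ?e = f ` e'" by blast
    have "e' \<subseteq> {1,2,3} \<times> ?V" using GS_form[OF e'(1)] by auto
    hence "?e = e'" using inj_on_image_eq_iff[OF finj eV] e'(2) by blast
    thus "sum_in_A p n x y z" using GS_edge[OF V] e'(1) by simp
  qed
  show ?thesis
    using that[of H a b c] H inj edge sub unfolding GS_embedding_def by blast
qed

section \<open>Decompositions\<close>

lemma K2_subset_nsets: "K2 X Y \<subseteq> [X \<union> Y]\<^bsup>2\<^esup>"
  by (auto simp: K2_def nsets_def)

lemma finite_K2: "finite X \<Longrightarrow> finite Y \<Longrightarrow> finite (K2 X Y)"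
  by (rule finite_subset[of _ "Pow (X \<union> Y)"]) (auto simp: K2_def)

text \<open>The split triple names three parts, distinct because \<open>R\<close> is reflexive, and
  large sets in them. The triad on these parts is regular by \<open>triads\<close>, against
  \<open>disc23_not_mixed\<close>.\<close>

lemma split_contradiction:
  fixes Vs :: "nat \<Rightarrow> 'a set"
  assumes p: "p \<ge> 3" and M: "1 \<le> M" "M \<le> n" and emb: "GS_embedding p n (hedges H) a b c"
    and finV: "\<And>i. i \<in> {1..t} \<Longrightarrow> finite (Vs i)"
    and disj: "disjoint_family_on Vs {1..t}"
    and part: "\<And>i j. i \<in> {1..t} \<Longrightarrow> j \<in> {1..t} \<Longrightarrow> i \<noteq> j \<Longrightarrow> K2 (Vs i) (Vs j) = (\<Union>\<alpha>\<in>{1..l}. P {i, j} \<alpha>)"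
    and l: "l \<ge> 1"
    and R: "\<And>i. R i i"
    and triads: "\<And>i j k \<alpha> \<beta> \<gamma>. i \<in> {1..t} \<Longrightarrow> j \<in> {1..t} \<Longrightarrow> k \<in> {1..t} \<Longrightarrow> \<not> R i j \<Longrightarrow> \<not> R i k \<Longrightarrow> \<not> R j k \<Longrightarrow>
      \<alpha> \<in> {1..l} \<Longrightarrow> \<beta> \<in> {1..l} \<Longrightarrow> \<gamma> \<in> {1..l} \<Longrightarrow> triad_disc23 \<epsilon>1 \<epsilon>2 H Vs P i j k \<alpha> \<beta> \<gamma>"
    and \<delta>: "\<delta> = 1 / (3072 * real p)" and \<epsilon>: "16 * \<epsilon>1 < \<delta> ^ 3" "0 \<le> \<epsilon>2" "256 * \<epsilon>2 * real l ^ 3 \<le> \<delta>\<^sup>2"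
    and ia: "\<And>x. x \<in> F_vecs p n \<Longrightarrow> fA x \<in> {1..t} \<and> a x \<in> Vs (fA x)"
    and ib: "\<And>x. x \<in> F_vecs p n \<Longrightarrow> fB x \<in> {1..t} \<and> b x \<in> Vs (fB x)"
    and ic: "\<And>x. x \<in> F_vecs p n \<Longrightarrow> fC x \<in> {1..t} \<and> c x \<in> Vs (fC x)"
    and v: "v = (\<lambda>i. card (Vs i))"
    and A0: "15 * p ^ n \<le> 16 * card {g \<in> F_vecs p n. heavy p n v fA g}"
    and A: "8 * card (typical p n v fA M) < 7 * p ^ n"
    and B: "7 * p ^ n \<le> 8 * card (typical p n v fB (M - 1))"
    and C: "7 * p ^ n \<le> 8 * card (typical p n v fC (M - 1))"
    and RAB: "10000 * p * card {(g, h) \<in> F_vecs p n \<times> F_vecs p n. R (fA g) (fB h)} \<le> (p ^ n)\<^sup>2"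
    and RAC: "10000 * p * card {(g, h) \<in> F_vecs p n \<times> F_vecs p n. R (fA g) (fC h)} \<le> (p ^ n)\<^sup>2"
    and RBC: "10000 * p * card {(g, h) \<in> F_vecs p n \<times> F_vecs p n. R (fB g) (fC h)} \<le> (p ^ n)\<^sup>2"
  shows False
proof -
  let ?V = "F_vecs p n"
  obtain x0 y0 z0 X X' Y Z where pts: "x0 \<in> ?V" "y0 \<in> ?V" "z0 \<in> ?V"
    and nR: "\<not> R (fA x0) (fB y0)" "\<not> R (fA x0) (fC z0)" "\<not> R (fB y0) (fC z0)"
    and sub: "X \<subseteq> cls p n fA x0" "X' \<subseteq> cls p n fA x0" "Y \<subseteq> cls p n fB y0" "Z \<subseteq> cls p n fC z0"
    and size: "v (fA x0) \<le> 3072 * p * card X" "v (fA x0) \<le> 3072 * p * card X'"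
      "v (fB y0) \<le> 3072 * p * card Y" "v (fC z0) \<le> 3072 * p * card Z"
    and inA: "\<forall>x\<in>X. \<forall>y\<in>Y. \<forall>z\<in>Z. sum_in_A p n x y z"
    and notinA: "\<forall>x\<in>X'. \<forall>y\<in>Y. \<forall>z\<in>Z. \<not> sum_in_A p n x y z"
    using exists_split_triple[OF p M A0 A B C RAB RAC RBC] .
  define i where "i = fA x0"
  define j where "j = fB y0"
  define k where "k = fC z0"
  have ijk: "i \<in> {1..t}" "j \<in> {1..t}" "k \<in> {1..t}" and mem: "a x0 \<in> Vs i" "b y0 \<in> Vs j" "c z0 \<in> Vs k"
    using ia[OF pts(1)] ib[OF pts(2)] ic[OF pts(3)] unfolding i_def j_def k_def by auto
  note nR = nR[folded i_def j_def k_def]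
  have ne: "i \<noteq> j" "i \<noteq> k" "j \<noteq> k" using nR R by metis+
  have fin: "finite (Vs i)" "finite (Vs j)" "finite (Vs k)" using finV ijk by auto
  have dj: "Vs i \<inter> Vs j = {}" "Vs i \<inter> Vs k = {}" "Vs j \<inter> Vs k = {}"
    using disj ijk ne unfolding disjoint_family_on_def by auto
  have pos: "card (Vs i) > 0" "card (Vs j) > 0" "card (Vs k) > 0"
    using fin mem by (auto simp: card_gt_0_iff)
  have XV: "X \<subseteq> ?V" "X' \<subseteq> ?V" "Y \<subseteq> ?V" "Z \<subseteq> ?V" using sub cls_subset by blast+
  have im: "a ` X \<subseteq> Vs i" "a ` X' \<subseteq> Vs i" "b ` Y \<subseteq> Vs j" "c ` Z \<subseteq> Vs k"
    using sub ia ib ic unfolding cls_def i_def j_def k_def by fastforce+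
  have inj: "inj_on a ?V" "inj_on b ?V" "inj_on c ?V" using emb unfolding GS_embedding_def by auto
  have ci: "card (a ` X) = card X" "card (a ` X') = card X'" "card (b ` Y) = card Y" "card (c ` Z) = card Z"
    using inj XV by (auto intro!: card_image intro: inj_on_subset)
  have scale: "\<delta> * real u \<le> real w" if "u \<le> 3072 * p * w" for u w
  proof -
    have "real u \<le> real (3072 * p * w)" using that by (simp only: of_nat_le_iff)
    thus ?thesis unfolding \<delta> using p by (simp add: field_simps)
  qed
  note size' = size[unfolded v, folded i_def j_def k_def, THEN scale]
  have "\<exists>\<alpha>\<in>{1..l}. card (Vs i) * card (Vs j) \<le> l * card (P {i, j} \<alpha>)"
  proof (rule ccontr)
    assume "\<not> ?thesis"
    hence lt: "l * card (P {i, j} \<alpha>) < card (Vs i) * card (Vs j)" if "\<alpha> \<in> {1..l}" for \<alpha>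
      using that by (simp add: not_le)
    have "card (K2 (Vs i) (Vs j)) = (\<Sum>u\<in>Vs i. card {w \<in> Vs j. {u, w} \<in> K2 (Vs i) (Vs j)})"
      using card_Int_K2[OF fin(1,2) dj(1), of "K2 (Vs i) (Vs j)"] by simp
    also have "\<dots> = (\<Sum>u\<in>Vs i. card (Vs j))"
      using dj(1) by (intro sum.cong refl arg_cong[of _ _ card]) (auto simp: doubleton_in_K2)
    finally have "card (Vs i) * card (Vs j) = card (\<Union>\<alpha>\<in>{1..l}. P {i, j} \<alpha>)"
      unfolding part[OF ijk(1,2) ne(1)] by simp
    also have "\<dots> \<le> (\<Sum>\<alpha>\<in>{1..l}. card (P {i, j} \<alpha>))" by (rule card_UN_le) simp
    finally have "l * (card (Vs i) * card (Vs j)) \<le> (\<Sum>\<alpha>\<in>{1..l}. l * card (P {i, j} \<alpha>))"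
      by (simp flip: sum_distrib_left)
    also have "\<dots> < (\<Sum>\<alpha>\<in>{1..l}. card (Vs i) * card (Vs j))" using lt l by (intro sum_strict_mono) auto
    finally show False by simp
  qed
  then obtain \<alpha> where \<alpha>: "\<alpha> \<in> {1..l}" and dens: "card (Vs i) * card (Vs j) \<le> l * card (P {i, j} \<alpha>)" by blast
  have one: "1 \<in> {1..l}" using l by simp
  \<comment> \<open>Only the pair \<open>i, j\<close> needs a dense graph, found by pigeonhole. The
    index 1 for the other two pairs is arbitrary, since \<open>disc23\<close> gives all three graphs
    the same density \<open>d2\<close>.\<close>
  define G where "G = triad Vs P i j k \<alpha> 1 1"
  have Psub: "P {i, j} \<alpha> \<subseteq> K2 (Vs i) (Vs j)" "P {i, k} 1 \<subseteq> K2 (Vs i) (Vs k)" "P {j, k} 1 \<subseteq> K2 (Vs j) (Vs k)"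
    using part[OF ijk(1,2) ne(1)] part[OF ijk(1,3) ne(2)] part[OF ijk(2,3) ne(3)] \<alpha> one by blast+
  have graphG: "graph2 G"
    unfolding graph2_def G_def triad_def fst_conv snd_conv
    using Psub K2_subset_nsets[of "Vs i" "Vs j"] K2_subset_nsets[of "Vs i" "Vs k"] K2_subset_nsets[of "Vs j" "Vs k"]
      nsets_mono[of "Vs i \<union> Vs j" "Vs i \<union> Vs j \<union> Vs k" 2] nsets_mono[of "Vs i \<union> Vs k" "Vs i \<union> Vs j \<union> Vs k" 2]
      nsets_mono[of "Vs j \<union> Vs k" "Vs i \<union> Vs j \<union> Vs k" 2] by blast
  have "P {i, j} \<alpha> \<subseteq> hedges G \<inter> K2 (Vs i) (Vs j)" using Psub unfolding G_def triad_def by auto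
  hence "card (P {i, j} \<alpha>) \<le> card (hedges G \<inter> K2 (Vs i) (Vs j))"
    using fin by (intro card_mono) (auto intro: finite_K2)
  hence dens': "card (Vs i) * card (Vs j) \<le> l * card (hedges G \<inter> K2 (Vs i) (Vs j))"
    using dens by (meson mult_le_mono2 order_trans)
  have disc: "disc23 \<epsilon>1 \<epsilon>2 (Vs i) (Vs j) (Vs k) (hverts G, hedges H \<inter> K3 G) G"
    using triads[OF ijk nR \<alpha> one one] unfolding triad_disc23_def Let_def G_def by simp
  have edge: "{a x, b y, c z} \<in> hedges H \<longleftrightarrow> sum_in_A p n x y z" if "x \<in> ?V" "y \<in> ?V" "z \<in> ?V" for x y z
    using emb that unfolding GS_embedding_def by blast
  show False
  proof (rule disc23_not_mixed[OF disc graphG fin dj pos l dens', of "a ` X" \<delta> "a ` X'" "b ` Y" "c ` Z"])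
    show "0 < \<delta>" "\<delta> \<le> 1" unfolding \<delta> using p by auto
    show "{x, y, z} \<in> hedges H" if "x \<in> a ` X" "y \<in> b ` Y" "z \<in> c ` Z" for x y z
      using that edge inA XV by blast
    show "{x, y, z} \<notin> hedges H" if "x \<in> a ` X'" "y \<in> b ` Y" "z \<in> c ` Z" for x y z
      using that edge notinA XV by blast
  qed (use im size' \<epsilon> ci in simp_all)
qed

text \<open>The bound \<open>10 ^ 12 * p ^ 3 \<le> t\<close> makes the diagonal pairs of indices as
  rare as those in \<open>\<Gamma>\<close>, and \<open>2 * t \<le> p ^ n\<close> leaves too few
  parts for most vectors to be alone of their kind. The values of \<open>\<epsilon>1\<close> and
  \<open>\<epsilon>2\<close> are fitted to \<open>\<delta> = 1 / (3072 * p)\<close> in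
  \<open>disc23_not_mixed\<close>.\<close>

lemma no_binary_error_decomposition:
  fixes Vs :: "nat \<Rightarrow> 'a set"
  assumes p: "p \<ge> 3" and n: "n \<ge> 1" and emb: "GS_embedding p n (hedges H) a b c"
    and H: "graph3 H"
    and W: "hverts H = a ` F_vecs p n \<union> b ` F_vecs p n \<union> c ` F_vecs p n"
    and dec: "decomposition t l \<epsilon>1 \<epsilon>2 (hverts H) Vs P"
    and \<Gamma>: "\<Gamma> \<subseteq> [{1..t}]\<^bsup>2\<^esup>" "real (card \<Gamma>) \<le> \<epsilon>1 * real t ^ 2"
    and triads: "\<And>i j k \<alpha> \<beta> \<gamma>. i \<in> {1..t} \<Longrightarrow> j \<in> {1..t} \<Longrightarrow> k \<in> {1..t} \<Longrightarrow> i \<noteq> j \<Longrightarrow> i \<noteq> k \<Longrightarrow> j \<noteq> k \<Longrightarrow>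
      {i, j} \<notin> \<Gamma> \<Longrightarrow> {i, k} \<notin> \<Gamma> \<Longrightarrow> {j, k} \<notin> \<Gamma> \<Longrightarrow>
      \<alpha> \<in> {1..l} \<Longrightarrow> \<beta> \<in> {1..l} \<Longrightarrow> \<gamma> \<in> {1..l} \<Longrightarrow> triad_disc23 \<epsilon>1 \<epsilon>2 H Vs P i j k \<alpha> \<beta> \<gamma>"
    and l: "l \<ge> 1" and t: "10 ^ 12 * p ^ 3 \<le> t" "2 * t \<le> p ^ n"
    and \<epsilon>1: "\<epsilon>1 = 1 / (10 ^ 12 * real p ^ 3)" and \<epsilon>2: "\<epsilon>2 = (1 / (3072 * real p))\<^sup>2 / (256 * real (l + 1) ^ 3)"
  shows False
proof -
  let ?V = "F_vecs p n"
  let ?N = "p ^ n"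
  have N: "?N > 0" using p by simp
  have "0 < 10 ^ 12 * p ^ 3" using p by simp
  hence t0: "t \<ge> 1" using t(1) by linarith
  have V: "hverts H = (\<Union>i\<in>{1..t}. Vs i)" and disj: "disjoint_family_on Vs {1..t}"
    and incr: "\<And>i j. i \<in> {1..t} \<Longrightarrow> j \<in> {1..t} \<Longrightarrow> i \<le> j \<Longrightarrow> card (Vs i) \<le> card (Vs j)"
    and bal: "card (Vs t) \<le> card (Vs 1) + 1"
    and part: "\<And>i j. i \<in> {1..t} \<Longrightarrow> j \<in> {1..t} \<Longrightarrow> i \<noteq> j \<Longrightarrow> K2 (Vs i) (Vs j) = (\<Union>\<alpha>\<in>{1..l}. P {i, j} \<alpha>)"
    using dec unfolding decomposition_def by auto
  have finW: "finite (hverts H)" unfolding W by simp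
  have finV: "finite (Vs i)" if "i \<in> {1..t}" for i
    using that finW V by (auto intro: finite_subset)
  have card3: "card e = 3" if "e \<in> hedges H" for e
    using H that unfolding graph3_def nsets_def by auto
  have cardW: "card (hverts H) = 3 * ?N"
  proof -
    have e12: "a ` ?V \<inter> b ` ?V = {}" using GS_embedding_disjoint[OF p n emb card3] .
    have e13: "a ` ?V \<inter> c ` ?V = {}" using GS_embedding_disjoint[OF p n GS_embedding_swap23[OF emb] card3] .
    have e23: "b ` ?V \<inter> c ` ?V = {}"
      using GS_embedding_disjoint[OF p n GS_embedding_swap23[OF GS_embedding_swap12[OF emb]] card3] .
    have "card (a ` ?V) = ?N" "card (b ` ?V) = ?N" "card (c ` ?V) = ?N"
      using emb unfolding GS_embedding_def by (simp_all add: card_image card_F_vecs)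
    thus ?thesis unfolding W using e12 e13 e23 by (simp add: card_Un_disjoint Int_Un_distrib2)
  qed
  define v where "v = (\<lambda>i. card (Vs i))"
  have sumv: "(\<Sum>i\<in>{1..t}. v i) = 3 * ?N"
    unfolding cardW[symmetric] V v_def
    using finV disj by (intro card_UN_disjoint[symmetric]) (auto simp: disjoint_family_on_def)
  have vbound: "t * v i \<le> 6 * ?N" if i: "i \<in> {1..t}" for i
  proof -
    have "v i \<le> v j + 1" if j: "j \<in> {1..t}" for j
      using incr[of i t] incr[of 1 j] bal i j t0 unfolding v_def by auto
    hence "(\<Sum>j\<in>{1..t}. v i) \<le> (\<Sum>j\<in>{1..t}. v j + 1)" by (intro sum_mono) auto
    also have "\<dots> = 3 * ?N + t" unfolding sum.distrib sumv by simp
    finally have "t * v i \<le> 3 * ?N + t" by simp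
    thus ?thesis using t(2) by linarith
  qed
  have "\<forall>w\<in>hverts H. \<exists>i\<in>{1..t}. w \<in> Vs i" unfolding V by blast
  then obtain idx where idx: "\<And>w. w \<in> hverts H \<Longrightarrow> idx w \<in> {1..t} \<and> w \<in> Vs (idx w)" by metis
  \<comment> \<open>Equal indices count as exceptional, so that avoiding \<open>R\<close> yields
    three different parts.\<close>
  define R where "R i j \<longleftrightarrow> i = j \<or> {i, j} \<in> \<Gamma>" for i j :: nat
  define RS where "RS = {(i, j) \<in> {1..t} \<times> {1..t}. R i j}"
  define good_emb where "good_emb e \<longleftrightarrow> inj_on e ?V \<and> (\<forall>x\<in>?V. idx (e x) \<in> {1..t} \<and> e x \<in> Vs (idx (e x)))"
    for e :: "(nat \<Rightarrow> int) \<Rightarrow> 'a"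
  have ge: "good_emb a" "good_emb b" "good_emb c"
    using emb idx W unfolding good_emb_def GS_embedding_def by auto
  have fibre: "card {g \<in> ?V. idx (e g) = i} \<le> v i" if "good_emb e" "i \<in> {1..t}" for e i
    unfolding v_def
  proof (rule card_inj_on_le)
    show "inj_on e {g \<in> ?V. idx (e g) = i}" using that(1) unfolding good_emb_def by (auto intro: inj_on_subset)
    show "e ` {g \<in> ?V. idx (e g) = i} \<subseteq> Vs i" using that(1) unfolding good_emb_def by auto
  qed (use finV that in auto)
  have finRS: "finite RS" unfolding RS_def by (rule finite_subset[of _ "{1..t} \<times> {1..t}"]) auto
  have fin\<Gamma>: "finite \<Gamma>"
    by (rule finite_subset[OF \<Gamma>(1)]) (simp add: finite_imp_finite_nsets)
  have cardRS: "real (card RS) \<le> 3 * \<epsilon>1 * real t ^ 2"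
  proof -
    have "RS \<subseteq> (\<lambda>i. (i, i)) ` {1..t} \<union> (\<Union>e\<in>\<Gamma>. {(i, j). i \<in> e \<and> j \<in> e \<and> i \<noteq> j})"
      unfolding RS_def R_def by auto
    hence "card RS \<le> card ((\<lambda>i. (i, i)) ` {1..t} \<union> (\<Union>e\<in>\<Gamma>. {(i, j). i \<in> e \<and> j \<in> e \<and> i \<noteq> j}))"
    proof (rule card_mono[rotated])
      have "finite {(i, j). i \<in> e \<and> j \<in> e \<and> i \<noteq> j}" if "e \<in> \<Gamma>" for e
      proof (rule finite_subset[of _ "e \<times> e"])
        have "finite e" using that \<Gamma>(1) unfolding nsets_def by auto
        thus "finite (e \<times> e)" by simp
      qed auto
      thus "finite ((\<lambda>i. (i, i)) ` {1..t} \<union> (\<Union>e\<in>\<Gamma>. {(i, j). i \<in> e \<and> j \<in> e \<and> i \<noteq> j}))"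
        using fin\<Gamma> by auto
    qed
    also have "\<dots> \<le> card ((\<lambda>i. (i, i)) ` {1..t}) + card (\<Union>e\<in>\<Gamma>. {(i, j). i \<in> e \<and> j \<in> e \<and> i \<noteq> j})"
      by (rule card_Un_le)
    also have "card ((\<lambda>i. (i, i)) ` {1..t}) \<le> t"
      using card_image_le[of "{1..t}" "\<lambda>i. (i, i)"] by simp
    also have "card (\<Union>e\<in>\<Gamma>. {(i, j). i \<in> e \<and> j \<in> e \<and> i \<noteq> j}) \<le> (\<Sum>e\<in>\<Gamma>. card {(i, j). i \<in> e \<and> j \<in> e \<and> i \<noteq> j})"
      by (rule card_UN_le[OF fin\<Gamma>])
    also have "\<dots> \<le> (\<Sum>e\<in>\<Gamma>. 2)"
    proof (rule sum_mono)
      fix e assume "e \<in> \<Gamma>"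
      hence "card e = 2" using \<Gamma>(1) unfolding nsets_def by auto
      then obtain x y where e: "e = {x, y}" by (auto simp: card_2_iff)
      have "{(i, j). i \<in> e \<and> j \<in> e \<and> i \<noteq> j} \<subseteq> {(x, y), (y, x)}" unfolding e by auto
      hence "card {(i, j). i \<in> e \<and> j \<in> e \<and> i \<noteq> j} \<le> card {(x, y), (y, x)}" by (intro card_mono) auto
      also have "\<dots> \<le> 2" using card_length[of "[(x, y), (y, x)]"] by simp
      finally show "card {(i, j). i \<in> e \<and> j \<in> e \<and> i \<noteq> j} \<le> 2" .
    qed
    finally have "card RS \<le> t + 2 * card \<Gamma>" by simp
    hence "real (card RS) \<le> real t + 2 * real (card \<Gamma>)" by linarith
    moreover have "real t \<le> \<epsilon>1 * real t ^ 2"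
    proof -
      have "real (10 ^ 12 * p ^ 3) \<le> real t" using t(1) by (simp only: of_nat_le_iff)
      hence "1 \<le> \<epsilon>1 * real t" unfolding \<epsilon>1 using p by (simp add: field_simps)
      hence "1 * real t \<le> (\<epsilon>1 * real t) * real t" by (intro mult_right_mono) auto
      thus ?thesis by (simp add: power2_eq_square mult_ac)
    qed
    ultimately show ?thesis using \<Gamma>(2) by linarith
  qed
  \<comment> \<open>Each of the at most \<open>3 * \<epsilon>1 * t\<^sup>2\<close> exceptional index
    pairs carries at most \<open>(6 * ?N / t)\<^sup>2\<close> pairs of vectors. This gives
    \<open>108 * \<epsilon>1 * ?N\<^sup>2\<close>, and \<open>pe\<close> absorbs the factor
    \<open>10000 * p\<close>.\<close>
  have pairs: "10000 * p * card {(g, h) \<in> ?V \<times> ?V. R (idx (e g)) (idx (e' h))} \<le> ?N\<^sup>2"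
    if ee: "good_emb e" "good_emb e'" for e e'
  proof -
    let ?D = "{(g, h) \<in> ?V \<times> ?V. R (idx (e g)) (idx (e' h))}"
    let ?F = "\<lambda>(i, j). {g \<in> ?V. idx (e g) = i} \<times> {h \<in> ?V. idx (e' h) = j}"
    have "?D \<subseteq> (\<Union>x\<in>RS. ?F x)"
      using ee unfolding RS_def good_emb_def by auto
    hence "card ?D \<le> card (\<Union>x\<in>RS. ?F x)"
      using finRS by (intro card_mono) auto
    also have "\<dots> \<le> (\<Sum>x\<in>RS. card (?F x))" by (rule card_UN_le[OF finRS])
    finally have "t\<^sup>2 * card ?D \<le> t\<^sup>2 * (\<Sum>x\<in>RS. card (?F x))" by (rule mult_le_mono2)
    also have "\<dots> = (\<Sum>x\<in>RS. t\<^sup>2 * card (?F x))" by (rule sum_distrib_left)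
    also have "\<dots> \<le> (\<Sum>x\<in>RS. 36 * ?N\<^sup>2)"
    proof (rule sum_mono)
      fix x assume "x \<in> RS"
      then obtain i j where x: "x = (i, j)" "i \<in> {1..t}" "j \<in> {1..t}" unfolding RS_def by auto
      have "card (?F x) \<le> v i * v j"
        unfolding x using fibre[OF ee(1) x(2)] fibre[OF ee(2) x(3)] by (simp add: card_cartesian_product mult_le_mono)
      hence "t\<^sup>2 * card (?F x) \<le> (t * v i) * (t * v j)"
        by (simp add: power2_eq_square mult_ac)
      also have "\<dots> \<le> (6 * ?N) * (6 * ?N)" using vbound[OF x(2)] vbound[OF x(3)] by (rule mult_le_mono)
      finally show "t\<^sup>2 * card (?F x) \<le> 36 * ?N\<^sup>2" by (simp add: power2_eq_square)
    qed
    also have "\<dots> = card RS * (36 * ?N\<^sup>2)" by simp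
    finally have "real (t\<^sup>2 * card ?D) \<le> real (card RS * (36 * ?N\<^sup>2))" by (simp only: of_nat_le_iff)
    hence "(real t)\<^sup>2 * real (card ?D) \<le> real (card RS) * (36 * (real ?N)\<^sup>2)" by simp
    also have "\<dots> \<le> (3 * \<epsilon>1 * real t ^ 2) * (36 * (real ?N)\<^sup>2)"
      using cardRS by (intro mult_right_mono) auto
    finally have "(real t)\<^sup>2 * real (card ?D) \<le> (real t)\<^sup>2 * (108 * \<epsilon>1 * (real ?N)\<^sup>2)"
      by (simp add: mult_ac)
    hence D: "real (card ?D) \<le> 108 * \<epsilon>1 * (real ?N)\<^sup>2"
      using t0 by (subst (asm) mult_le_cancel_left_pos) auto
    have pe: "1080000 * real p * \<epsilon>1 \<le> 1"
    proof -
      have "real p * 1 \<le> real p * real p ^ 2" using p by (intro mult_left_mono) auto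
      hence "real p \<le> real p ^ 3" by (simp add: power3_eq_cube power2_eq_square)
      hence "1080000 * real p \<le> 10 ^ 12 * real p ^ 3" by (intro mult_mono) auto
      thus ?thesis unfolding \<epsilon>1 using p by (simp add: divide_simps)
    qed
    have "10000 * real p * real (card ?D) \<le> 10000 * real p * (108 * \<epsilon>1 * (real ?N)\<^sup>2)"
      using D by (intro mult_left_mono) auto
    also have "\<dots> = (1080000 * real p * \<epsilon>1) * (real ?N)\<^sup>2" by simp
    also have "\<dots> \<le> 1 * (real ?N)\<^sup>2" using pe by (intro mult_right_mono) auto
    finally have "real (10000 * p * card ?D) \<le> real (?N\<^sup>2)" by simp
    thus ?thesis by (simp only: of_nat_le_iff)
  qed
  have heavy: "15 * ?N \<le> 16 * card {g \<in> ?V. heavy p n v (\<lambda>x. idx (e x)) g}" if e: "good_emb e" for e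
  proof -
    let ?f = "\<lambda>x. idx (e x)"
    let ?L = "{g \<in> ?V. \<not> heavy p n v ?f g}"
    have "card ?L = (\<Sum>i\<in>{1..t}. card {g \<in> ?L. ?f g = i})"
      using sum.group[of ?L "{1..t}" ?f "\<lambda>_. 1::nat"] e unfolding good_emb_def by (simp add: image_subset_iff)
    hence "48 * card ?L = (\<Sum>i\<in>{1..t}. 48 * card {g \<in> ?L. ?f g = i})" by (simp add: sum_distrib_left)
    also have "\<dots> \<le> (\<Sum>i\<in>{1..t}. v i)"
    proof (rule sum_mono)
      fix i
      show "48 * card {g \<in> ?L. ?f g = i} \<le> v i"
      proof (cases "{g \<in> ?L. ?f g = i} = {}")
        case False
        then obtain g where g: "g \<in> ?L" "?f g = i" by blast
        have "card {g \<in> ?L. ?f g = i} \<le> card (cls p n ?f g)"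
          using g(2) by (intro card_mono) (auto simp: cls_def)
        moreover have "48 * card (cls p n ?f g) < v i" using g unfolding heavy_def by auto
        ultimately show ?thesis by linarith
      next
        case True
        show ?thesis unfolding True by simp
      qed
    qed
    finally have "16 * card ?L \<le> ?N" unfolding sumv by linarith
    moreover have "card {g \<in> ?V. heavy p n v ?f g} + card ?L = ?N"
      unfolding card_F_vecs[symmetric] by (subst card_Un_disjoint[symmetric]) (auto intro: arg_cong[of _ _ card])
    ultimately show ?thesis by linarith
  qed
  define low where "low m e \<longleftrightarrow> 8 * card (typical p n v (\<lambda>x. idx (e x)) m) < 7 * ?N"
    for m and e :: "(nat \<Rightarrow> int) \<Rightarrow> 'a"
  have not_low0: "\<not> low 0 e" if e: "good_emb e" for e
  proof -
    let ?f = "\<lambda>x. idx (e x)"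
    have "{g \<in> ?V. heavy p n v ?f g} \<subseteq> typical p n v ?f 0"
    proof
      fix g assume g: "g \<in> {g \<in> ?V. heavy p n v ?f g}"
      hence "g \<in> cls p n ?f g" by (simp add: cls_def)
      hence "0 < card (cls p n ?f g)" by (auto simp: card_gt_0_iff)
      thus "g \<in> typical p n v ?f 0" using g unfolding typical_def conc_def by auto
    qed
    hence "card {g \<in> ?V. heavy p n v ?f g} \<le> card (typical p n v ?f 0)"
      by (rule card_mono[rotated]) (simp add: typical_def)
    thus ?thesis using heavy[OF e] unfolding low_def by linarith
  qed
  \<comment> \<open>Cells of level \<open>n\<close> are single vectors, so a part concentrated at
    that level has just one vector of this kind. Hence at most \<open>t\<close> vectors are typical,
    which is at most half of all.\<close>
  have low_n: "low n a"
  proof -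
    let ?f = "\<lambda>x. idx (a x)"
    have single: "card (cls p n ?f g) \<le> 1" if g: "g \<in> typical p n v ?f n" for g
    proof -
      obtain h where h: "h \<in> ?V" "7 * card (cls p n ?f g) < 8 * card {x \<in> cls p n ?f g. agree n h x}"
        using g unfolding typical_def conc_def by blast
      have "{x \<in> cls p n ?f g. agree n h x} \<subseteq> {h}" using F_vecs_eqI[OF h(1)] cls_subset[of p n ?f g] by blast
      hence "card {x \<in> cls p n ?f g. agree n h x} \<le> card {h}" by (intro card_mono) auto
      thus ?thesis using h(2) by simp
    qed
    have "inj_on ?f (typical p n v ?f n)"
    proof (rule inj_onI)
      fix g h assume gh: "g \<in> typical p n v ?f n" "h \<in> typical p n v ?f n" "?f g = ?f h"
      have "g \<in> cls p n ?f g" "h \<in> cls p n ?f g" using gh unfolding typical_def cls_def by auto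
      thus "g = h" using single[OF gh(1)] card_le_Suc0_iff_eq[of "cls p n ?f g"] by auto
    qed
    moreover have "?f ` typical p n v ?f n \<subseteq> {1..t}" using ge(1) unfolding good_emb_def typical_def by auto
    ultimately have "card (typical p n v ?f n) \<le> card {1..t}" by (rule card_inj_on_le) simp
    hence "card (typical p n v ?f n) \<le> t" by simp
    thus ?thesis using t(2) N unfolding low_def by linarith
  qed
  \<comment> \<open>The first level at which one of the three kinds breaks up. By the symmetry of
    \<open>GS_embedding\<close> that kind can take the first role in
    \<open>split_contradiction\<close>; the other two are still concentrated at level
    \<open>M - 1\<close>.\<close>
  define M where "M = (LEAST m. low m a \<or> low m b \<or> low m c)"
  have Mn: "M \<le> n" unfolding M_def using low_n by (intro Least_le) blast
  have lowM: "low M a \<or> low M b \<or> low M c"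
    unfolding M_def using low_n by (intro LeastI[where P = "\<lambda>m. low m a \<or> low m b \<or> low m c"]) blast
  have M1: "1 \<le> M" using lowM not_low0 ge by (cases M) auto
  have prev: "\<not> low (M - 1) a" "\<not> low (M - 1) b" "\<not> low (M - 1) c"
    using not_less_Least[of "M - 1" "\<lambda>m. low m a \<or> low m b \<or> low m c"] M1 unfolding M_def[symmetric] by auto
  let ?\<delta> = "1 / (3072 * real p)"
  have p0: "real p > 0" using p by simp
  have e1: "16 * \<epsilon>1 < ?\<delta> ^ 3" unfolding \<epsilon>1 using p0 by (simp add: power_divide power_mult_distrib divide_simps)
  have e2: "0 \<le> \<epsilon>2" unfolding \<epsilon>2 by simp
  have e3: "256 * \<epsilon>2 * real l ^ 3 \<le> ?\<delta>\<^sup>2"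
  proof -
    have "real l ^ 3 \<le> real (l + 1) ^ 3" by (intro power_mono) auto
    hence "256 * \<epsilon>2 * real l ^ 3 \<le> 256 * \<epsilon>2 * real (l + 1) ^ 3" using e2 by (intro mult_left_mono) auto
    also have "\<dots> = ?\<delta>\<^sup>2" unfolding \<epsilon>2 by simp
    finally show ?thesis .
  qed
  have contra: False
    if emb': "GS_embedding p n (hedges H) x y z" and g: "good_emb x" "good_emb y" "good_emb z"
      and low: "low M x" "\<not> low (M - 1) y" "\<not> low (M - 1) z" for x y z
  proof (rule split_contradiction[OF p M1 Mn emb' finV disj part l _ _ refl e1 e2 e3 _ _ _ v_def heavy[OF g(1)]
      _ _ _ pairs[OF g(1,2)] pairs[OF g(1,3)] pairs[OF g(2,3)]])
    show "R i i" for i unfolding R_def by simp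
    show "triad_disc23 \<epsilon>1 \<epsilon>2 H Vs P i j k \<alpha> \<beta> \<gamma>"
      if "i \<in> {1..t}" "j \<in> {1..t}" "k \<in> {1..t}" "\<not> R i j" "\<not> R i k" "\<not> R j k"
        "\<alpha> \<in> {1..l}" "\<beta> \<in> {1..l}" "\<gamma> \<in> {1..l}" for i j k \<alpha> \<beta> \<gamma>
      using that by (intro triads) (auto simp: R_def)
  qed (use g low in \<open>auto simp: good_emb_def low_def not_less\<close>)
  show False
    using lowM
  proof (elim disjE)
    assume "low M a"
    thus False using contra[OF emb ge] prev by blast
  next
    assume "low M b"
    thus False using contra[OF GS_embedding_swap12[OF emb] ge(2,1,3)] prev by blast
  next
    assume "low M c"
    thus False
      using contra[OF GS_embedding_swap12[OF GS_embedding_swap23[OF emb]] ge(3,1,2)] prev by blast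
  qed
qed

section \<open>Choice of the parameters\<close>

theorem theorem2p58:
  fixes p :: nat and \<H> :: "nat hgraph set"
  assumes "prime p" and "p \<ge> 3"
    and "hereditary_property \<H>"
    and "\<And>n::nat. n \<ge> 1 \<Longrightarrow> in_Trip (GS p n) \<H>"
  shows "requires_nonbinary_disc23_error \<H>"
  unfolding requires_nonbinary_disc23_error_def
proof
  assume adm: "admits_binary_disc23_error \<H>"
  define \<epsilon>1 where "\<epsilon>1 = 1 / (10 ^ 12 * real p ^ 3)"
  \<comment> \<open>The shift to \<open>l + 1\<close> keeps the value at 0 positive; division by
    zero would give 0.\<close>
  define \<epsilon>2 where "\<epsilon>2 l = (1 / (3072 * real p))\<^sup>2 / (256 * real (l + 1) ^ 3)" for l :: nat
  have p0: "real p > 0" using assms(2) by simp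
  have p1: "real p \<ge> 1" using assms(2) by simp
  have e1: "\<epsilon>1 > 0" unfolding \<epsilon>1_def using p0 by simp
  have e2: "\<forall>m. 0 < \<epsilon>2 m \<and> \<epsilon>2 m \<le> 1"
  proof (intro allI conjI)
    fix m
    show "0 < \<epsilon>2 m" unfolding \<epsilon>2_def using p0 by simp
    have "(1 / (3072 * real p))\<^sup>2 \<le> 1" using p1 by (intro power_le_one) (auto simp: divide_simps)
    moreover have "1 \<le> 256 * real (m + 1) ^ 3" using one_le_power[of "real (m + 1)" 3] by linarith
    ultimately show "\<epsilon>2 m \<le> 1" unfolding \<epsilon>2_def by (subst divide_le_eq_1_pos) linarith+
  qed
  have t0: "10 ^ 12 * p ^ 3 \<ge> 1" using assms(2) by simp
  obtain N T L :: nat where NTL: "\<forall>H\<in>\<H>. N \<le> card (hverts H) \<longrightarrow>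
         (\<exists>t l Vs P \<Gamma>. 10 ^ 12 * p ^ 3 \<le> t \<and> t \<le> T \<and> 1 \<le> l \<and> l \<le> L \<and>
            decomposition t l \<epsilon>1 (\<epsilon>2 l) (hverts H) Vs P \<and>
            \<Gamma> \<subseteq> [{1..t}]\<^bsup>2\<^esup> \<and> real (card \<Gamma>) \<le> \<epsilon>1 * real t ^ 2 \<and>
            (\<forall>i\<in>{1..t}. \<forall>j\<in>{1..t}. \<forall>k\<in>{1..t}. i \<noteq> j \<and> i \<noteq> k \<and> j \<noteq> k \<and>
               {i, j} \<notin> \<Gamma> \<and> {i, k} \<notin> \<Gamma> \<and> {j, k} \<notin> \<Gamma> \<longrightarrow>
               (\<forall>\<alpha>\<in>{1..l}. \<forall>\<beta>\<in>{1..l}. \<forall>\<gamma>\<in>{1..l}.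
                  triad_disc23 \<epsilon>1 (\<epsilon>2 l) H Vs P i j k \<alpha> \<beta> \<gamma>)))"
    using adm[unfolded admits_binary_disc23_error_def, THEN spec, THEN mp, OF t0, THEN spec, THEN mp,
        OF order_refl, THEN spec, THEN mp, OF e1, THEN spec, THEN mp, OF e2]
    by (elim exE) (rule that)
  \<comment> \<open>As \<open>p ^ n > n\<close>, this ensures at least \<open>N\<close> vertices and
    \<open>2 * t \<le> p ^ n\<close> for all \<open>t \<le> T\<close>. The summand 2 serves the
    uniqueness of the 3-partition.\<close>
  define n where "n = N + 2 * T + 2"
  have "n < 2 ^ n" by (rule less_exp)
  also have "(2::nat) ^ n \<le> p ^ n" using assms(2) by (intro power_mono) auto
  finally have pn: "n < p ^ n" .
  have n: "n \<ge> 1" "n \<ge> 2" unfolding n_def by auto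
  obtain H a b c where H: "H \<in> \<H>" and emb: "GS_embedding p n (hedges H) a b c"
    and sub: "a ` F_vecs p n \<union> b ` F_vecs p n \<union> c ` F_vecs p n \<subseteq> hverts H"
    using in_Trip_GS_embedding[OF assms(2) n(2) assms(4)[OF n(1)]] .
  define W where "W = a ` F_vecs p n \<union> b ` F_vecs p n \<union> c ` F_vecs p n"
  \<comment> \<open>Heredity allows restricting to the image of the embedding, so that the part
    sizes add up to exactly \<open>3 * p ^ n\<close>.\<close>
  define H' where "H' = induced_sub H W"
  have H': "H' \<in> \<H>" using assms(3) H sub unfolding hereditary_property_def H'_def W_def by blast
  hence g3: "graph3 H'" using assms(3) unfolding hereditary_property_def by blast
  have verts: "hverts H' = W" unfolding H'_def induced_sub_def by simp
  have emb': "GS_embedding p n (hedges H') a b c"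
  proof -
    have "{a x, b y, c z} \<subseteq> W" if "x \<in> F_vecs p n" "y \<in> F_vecs p n" "z \<in> F_vecs p n" for x y z
      using that unfolding W_def by blast
    thus ?thesis using emb unfolding GS_embedding_def H'_def induced_sub_def by simp
  qed
  have "card (a ` F_vecs p n) = p ^ n" using emb unfolding GS_embedding_def by (simp add: card_image card_F_vecs)
  moreover have "card (a ` F_vecs p n) \<le> card W" unfolding W_def by (intro card_mono) auto
  ultimately have "N \<le> card (hverts H')" using pn unfolding verts n_def by linarith
  from NTL[THEN bspec, OF H', THEN mp, OF this] obtain t l Vs P \<Gamma> where tl: "10 ^ 12 * p ^ 3 \<le> t" "t \<le> T" "1 \<le> l"
    and dec: "decomposition t l \<epsilon>1 (\<epsilon>2 l) (hverts H') Vs P"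
    and \<Gamma>: "\<Gamma> \<subseteq> [{1..t}]\<^bsup>2\<^esup>" "real (card \<Gamma>) \<le> \<epsilon>1 * real t ^ 2"
    and triads: "\<forall>i\<in>{1..t}. \<forall>j\<in>{1..t}. \<forall>k\<in>{1..t}. i \<noteq> j \<and> i \<noteq> k \<and> j \<noteq> k \<and>
               {i, j} \<notin> \<Gamma> \<and> {i, k} \<notin> \<Gamma> \<and> {j, k} \<notin> \<Gamma> \<longrightarrow>
               (\<forall>\<alpha>\<in>{1..l}. \<forall>\<beta>\<in>{1..l}. \<forall>\<gamma>\<in>{1..l}.
                  triad_disc23 \<epsilon>1 (\<epsilon>2 l) H' Vs P i j k \<alpha> \<beta> \<gamma>)"
    by (elim exE conjE) (rule that)
  show False
  proof (rule no_binary_error_decomposition[OF assms(2) n(1) emb' g3 _ dec \<Gamma> _ tl(3,1) _ \<epsilon>1_def \<epsilon>2_def])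
    show "hverts H' = a ` F_vecs p n \<union> b ` F_vecs p n \<union> c ` F_vecs p n" unfolding verts W_def ..
    show "2 * t \<le> p ^ n" using tl(2) pn unfolding n_def by linarith
    show "triad_disc23 \<epsilon>1 (\<epsilon>2 l) H' Vs P i j k \<alpha> \<beta> \<gamma>"
      if "i \<in> {1..t}" "j \<in> {1..t}" "k \<in> {1..t}" "i \<noteq> j" "i \<noteq> k" "j \<noteq> k"
        "{i, j} \<notin> \<Gamma>" "{i, k} \<notin> \<Gamma>" "{j, k} \<notin> \<Gamma>" "\<alpha> \<in> {1..l}" "\<beta> \<in> {1..l}" "\<gamma> \<in> {1..l}"
      for i j k \<alpha> \<beta> \<gamma>
      using triads that by blast
  qed
qed

end
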